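(* Let $k \ge 3$. For $n \in \mathbb{N}$ and $p \in (0,1]$, let $[n]_p$ be the random subset of $[n]=\{1,\ldots,n\}$ in which each element is included independently with probability $p$, and let $X=X_{k,n,p}$ be the number of arithmetic progressions of length $k$ contained in $[n]_p$. Set $\mu=\mathbb{E} X$. There are constants $n_0,b,B>0$ (depending only on $k$) such that for all $n \ge n_0$, $p \in (0,1]$ and $\varepsilon>0$ we have \[ \mathbf{1}\{1 \le (1+\varepsilon)\mu \le X_{k,n,1}\}\exp\bigl(-C(\varepsilon)\Phi\bigr) \le \Pr(X \ge (1+\varepsilon)\mu) \le \exp\bigl(-c(\varepsilon)\Phi\bigr), \] where $\Phi=\min\{\mu,\sqrt{\mu}\log(1/p)\}$, $c(\varepsilon)=b\min\{\varepsilon^3,\varepsilon^{1/2}\}$ and $C(\varepsilon)=B\max\{1,\varepsilon^2\}$.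
   Context: An arithmetic progression of length $k$ in $[n]$ is a $k$-element subset $\{x_1,\ldots,x_k\}\subseteq[n]$ whose elements form an arithmetic progression. $X_{k,n,1}$ is the (deterministic) total number of such progressions in $[n]$. $\mathbf{1}\{\cdot\}$ denotes the indicator, and $\log$ is the natural logarithm. *)

theory Defs
  imports "HOL-Probability.Probability"
begin

text \<open>The condition \<^term>\<open>card S = k\<close> forces a positive common difference when
  \<^term>\<open>k \<ge> (2::nat)\<close>. Progressions are counted as sets, so a progression and its
  reversal are the same object.\<close>

definition arith_prog :: "nat \<Rightarrow> nat set \<Rightarrow> bool" where
  "arith_prog k S \<longleftrightarrow> card S = k \<and> (\<exists>a d. S = (\<lambda>i. a + i * d) ` {..<k})"

definition num_AP :: "nat \<Rightarrow> nat set \<Rightarrow> nat" where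
  "num_AP k A = card {S. S \<subseteq> A \<and> arith_prog k S}"

definition random_subset :: "nat \<Rightarrow> real \<Rightarrow> nat set pmf" where
  "random_subset n p =
     map_pmf (\<lambda>f. {x \<in> {1..n}. f x}) (Pi_pmf {1..n} False (\<lambda>_. bernoulli_pmf p))"

definition mean_AP :: "nat \<Rightarrow> nat \<Rightarrow> real \<Rightarrow> real" where
  "mean_AP k n p = measure_pmf.expectation (random_subset n p) (\<lambda>A. real (num_AP k A))"

definition rate_Phi :: "nat \<Rightarrow> nat \<Rightarrow> real \<Rightarrow> real" where
  "rate_Phi k n p = min (mean_AP k n p) (sqrt (mean_AP k n p) * ln (1 / p))"

end

theory Submission
  imports Defs
begin

text \<open>Work in a \<open>k\<close>-uniform hypergraph whose degrees and codegrees are those of the progressions, and let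
  \<open>cond_mean U\<close> be the expected number of edges in the random set, given that it contains \<open>U\<close>.

  Upper tail: if every \<open>U\<close> of at most \<open>k * l\<close> vertices inside the random set has
  \<open>cond_mean U \<le> (1 + \<epsilon> / 2) * \<mu>\<close>, then expanding the \<open>l\<close>-th moment edge by edge gives the bound
  \<open>((1 + \<epsilon> / 2) / (1 + \<epsilon>)) ^ l\<close>. With \<open>l\<close> proportional to \<open>\<Phi>\<close>, an exceptional \<open>U\<close> must itself span about
  \<open>\<epsilon> * \<mu>\<close> edges. Such a set contains either one vertex of degree about \<open>sqrt (\<epsilon> * \<mu>)\<close> or many disjoint stars
  of total size about \<open>sqrt (\<epsilon> * \<mu>)\<close>, and a union bound makes both unlikely.

  Lower tail: either plant an interval of about \<open>sqrt ((1 + \<epsilon>) * \<mu>)\<close> elements, or, when this is too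
  expensive, bound a truncated moment of order \<open>t = \<lceil>(1 + \<epsilon>) * \<mu>\<rceil>\<close> from below by adding
  edges one at a time so that \<open>cond_mean\<close> grows by at most 2 in each step.\<close>

section \<open>Moments of the edge count\<close>

text \<open>A plain moment bound fails because a short interval \<open>U\<close> may alone span more
  than \<epsilon> * \<mu> edges; hence the moments are restricted to an event that excludes such
  \<open>U\<close>. The star size comes from the following balance. Put L = ln (1/p) and m = max 1
  (sqrt \<mu> / L), so that \<Phi> = \<mu> / m. As \<open>card U\<close> is of order \<Phi>, star
  size d of order m keeps d * card U below \<epsilon> * \<mu> up to constants. At that size stars
  are already rare: for k at least 3, n * p^(k-1) is at most of order sqrt \<mu> * p^(1/2), and the
  spare power of p beats L. The vertices covered by the stars number about K, of order sqrt
  (\<epsilon> * \<mu>), and have degree about K, hence carry about K^2 edges. Both star events cost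
  K * L, at least of order sqrt \<epsilon> * \<Phi>; this is the exponent 1/2. For small \<epsilon>
  the power 3 has three sources: the order of the moment, the ratio (1 + \<epsilon>/2) / (1 +
  \<epsilon>), and Markov's inequality, which takes over where the factor 3 from a union of three
  events cannot be absorbed.\<close>

locale binomial_hypergraph =
  fixes V :: "'a set" and H :: "'a set set" and k \<Delta> \<kappa> :: nat and p :: real
    and M :: "'a set pmf"
  assumes finite_V: "finite V"
    and edge_subset: "S \<in> H \<Longrightarrow> S \<subseteq> V"
    and card_edge: "S \<in> H \<Longrightarrow> card S = k"
    and k_ge_2: "2 \<le> k"
    and degree_le: "v \<in> V \<Longrightarrow> card {S \<in> H. v \<in> S} \<le> \<Delta>"
    and codegree_le: "x \<noteq> y \<Longrightarrow> card {S \<in> H. x \<in> S \<and> y \<in> S} \<le> \<kappa>"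
    and p_pos: "0 < p" and p_le_1: "p \<le> 1"
    and support: "A \<in> set_pmf M \<Longrightarrow> A \<subseteq> V"
    and prob_superset: "U \<subseteq> V \<Longrightarrow> measure_pmf.prob M {A. U \<subseteq> A} = p ^ card U"
begin

definition num_edges :: "'a set \<Rightarrow> nat" where
  "num_edges A = card {S \<in> H. S \<subseteq> A}"

text \<open>By \<open>prob_superset\<close>, an edge \<open>T\<close> is present given
  \<open>U\<close> with probability \<open>p ^ card (T - U)\<close>, so no conditional pmf is
  required. Independence enters the whole argument only through
  \<open>prob_superset\<close>.\<close>

definition cond_mean :: "'a set \<Rightarrow> real" where
  "cond_mean U = (\<Sum>T\<in>H. p ^ card (T - U))"

abbreviation E :: "('a set \<Rightarrow> real) \<Rightarrow> real" where
  "E f \<equiv> measure_pmf.expectation M f"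

lemma finite_H: "finite H"
  using finite_V edge_subset by (meson finite_Pow_iff PowI finite_subset subsetI)

lemma finite_edge: "S \<in> H \<Longrightarrow> finite S"
  using edge_subset finite_V finite_subset by blast

lemma finite_support: "finite (set_pmf M)"
  using finite_V support by (meson finite_Pow_iff PowI finite_subset subsetI)

lemma integrable_M [simp]: "integrable (measure_pmf M) (f :: 'a set \<Rightarrow> real)"
  by (rule integrable_measure_pmf_finite[OF finite_support])

lemma E_mono: "(\<And>A. A \<subseteq> V \<Longrightarrow> f A \<le> g A) \<Longrightarrow> E f \<le> E g"
  by (rule integral_mono_AE) (auto simp: AE_measure_pmf_iff support)

lemma E_cong: "(\<And>A. A \<subseteq> V \<Longrightarrow> f A = g A) \<Longrightarrow> E f = E g"
  by (rule integral_cong_AE) (auto simp: AE_measure_pmf_iff support)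

lemma E_of_bool: "E (\<lambda>A. of_bool (P A)) = measure_pmf.prob M {A. P A}"
proof -
  have "E (\<lambda>A. of_bool (P A)) = E (indicator {A. P A})"
    by (rule E_cong) (auto simp: indicator_def)
  then show ?thesis by simp
qed

lemma prob_mono: "(\<And>A. A \<subseteq> V \<Longrightarrow> P A \<Longrightarrow> Q A) \<Longrightarrow>
    measure_pmf.prob M {A. P A} \<le> measure_pmf.prob M {A. Q A}"
  unfolding E_of_bool[symmetric] by (rule E_mono) auto

lemma E_superset: "U \<subseteq> V \<Longrightarrow> E (\<lambda>A. of_bool (U \<subseteq> A)) = p ^ card U"
  by (simp add: E_of_bool prob_superset)

lemma E_sum: "E (\<lambda>A. \<Sum>i\<in>I. f i A) = (\<Sum>i\<in>I. E (f i))"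
  by (rule Bochner_Integration.integral_sum) simp

lemma num_edges_sum: "real (num_edges A) = (\<Sum>T\<in>H. of_bool (T \<subseteq> A))"
  unfolding num_edges_def using finite_H by (simp add: Int_def)

text \<open>The source of every moment expansion: choosing one further edge multiplies the weight
  \<open>p ^ card U\<close> by \<open>cond_mean U\<close>.\<close>

lemma sum_card_Un_power:
  assumes "U \<subseteq> V"
  shows "(\<Sum>T\<in>H. p ^ card (U \<union> T)) = p ^ card U * cond_mean U"
proof -
  have "card (U \<union> T) = card U + card (T - U)" if "T \<in> H" for T
    using assms that finite_V finite_edge finite_subset
    by (metis Diff_disjoint Un_Diff_cancel card_Un_disjoint finite_Diff)
  then show ?thesis
    by (simp add: cond_mean_def sum_distrib_left power_add)
qed

lemma E_num_edges_superset:
  assumes "U \<subseteq> V"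
  shows "E (\<lambda>A. real (num_edges A) * of_bool (U \<subseteq> A)) = p ^ card U * cond_mean U"
proof -
  have "E (\<lambda>A. real (num_edges A) * of_bool (U \<subseteq> A)) = E (\<lambda>A. \<Sum>T\<in>H. of_bool (U \<union> T \<subseteq> A))"
    by (rule E_cong) (auto simp: num_edges_sum sum_distrib_right intro!: sum.cong)
  also have "\<dots> = (\<Sum>T\<in>H. p ^ card (U \<union> T))"
    unfolding E_sum using assms edge_subset by (intro sum.cong refl E_superset) auto
  finally show ?thesis using sum_card_Un_power[OF assms] by simp
qed

lemma cond_mean_empty: "cond_mean {} = real (card H) * p ^ k"
  by (simp add: cond_mean_def card_edge)

lemma E_num_edges: "E (\<lambda>A. real (num_edges A)) = real (card H) * p ^ k"
  using E_num_edges_superset[of "{}"] cond_mean_empty by simp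

text \<open>Expanding one factor of the power as a sum over edges replaces \<open>U\<close> by
  \<open>U \<union> T\<close>, uses at most \<open>k\<close> vertices of the budget
  \<open>k * l\<close> and contributes a factor \<open>cond_mean U\<close>. The event
  \<open>\<A>\<close> is carried along unexpanded.\<close>

lemma moment_superset_le:
  assumes "\<And>A U. A \<in> \<A> \<Longrightarrow> U \<subseteq> A \<Longrightarrow> A \<subseteq> V \<Longrightarrow> card U \<le> k * l \<Longrightarrow> cond_mean U \<le> \<beta>"
    and "0 \<le> \<beta>" and "U \<subseteq> V" and "card U + k * j \<le> k * l"
  shows "E (\<lambda>A. real (num_edges A) ^ j * of_bool (A \<in> \<A> \<and> U \<subseteq> A)) \<le> \<beta> ^ j * p ^ card U"
  using assms(3,4)
proof (induction j arbitrary: U)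
  case 0
  have "E (\<lambda>A. of_bool (A \<in> \<A> \<and> U \<subseteq> A)) \<le> E (\<lambda>A. of_bool (U \<subseteq> A))"
    by (rule E_mono) auto
  then show ?case using E_superset[OF 0(1)] by simp
next
  case (Suc j)
  show ?case
  proof (cases "cond_mean U \<le> \<beta>")
    case True
    have step: "real (num_edges A) ^ Suc j * of_bool (A \<in> \<A> \<and> U \<subseteq> A) =
        (\<Sum>T\<in>H. real (num_edges A) ^ j * of_bool (A \<in> \<A> \<and> U \<union> T \<subseteq> A))" for A
    proof -
      have "real (num_edges A) ^ Suc j * of_bool (A \<in> \<A> \<and> U \<subseteq> A) =
        real (num_edges A) * (real (num_edges A) ^ j * of_bool (A \<in> \<A> \<and> U \<subseteq> A))" by simp
      also have "\<dots> = (\<Sum>T\<in>H. of_bool (T \<subseteq> A) * (real (num_edges A) ^ j * of_bool (A \<in> \<A> \<and> U \<subseteq> A)))"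
        by (subst num_edges_sum) (simp only: sum_distrib_right)
      also have "\<dots> = (\<Sum>T\<in>H. real (num_edges A) ^ j * of_bool (A \<in> \<A> \<and> U \<union> T \<subseteq> A))"
        by (intro sum.cong) auto
      finally show ?thesis .
    qed
    have "E (\<lambda>A. real (num_edges A) ^ Suc j * of_bool (A \<in> \<A> \<and> U \<subseteq> A)) =
        (\<Sum>T\<in>H. E (\<lambda>A. real (num_edges A) ^ j * of_bool (A \<in> \<A> \<and> U \<union> T \<subseteq> A)))"
      unfolding step E_sum ..
    also have "\<dots> \<le> (\<Sum>T\<in>H. \<beta> ^ j * p ^ card (U \<union> T))"
    proof (intro sum_mono Suc.IH)
      fix T assume T: "T \<in> H"
      then show "U \<union> T \<subseteq> V" using Suc.prems edge_subset by auto
      show "card (U \<union> T) + k * j \<le> k * l"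
        using card_Un_le[of U T] card_edge[OF T] Suc.prems by simp
    qed
    also have "\<dots> = \<beta> ^ j * p ^ card U * cond_mean U"
      using sum_card_Un_power[OF Suc.prems(1)] by (simp add: sum_distrib_left[symmetric])
    also have "\<dots> \<le> \<beta> ^ j * p ^ card U * \<beta>"
      using True assms(2) p_pos by (intro mult_left_mono) auto
    finally show ?thesis by (simp add: mult_ac)
  next
    \<comment> \<open>Such a \<open>U\<close> is contained in no \<open>A\<close> of the event
      \<open>\<A>\<close>, so the integrand vanishes.\<close>
    case False
    have "E (\<lambda>A. real (num_edges A) ^ Suc j * of_bool (A \<in> \<A> \<and> U \<subseteq> A)) = E (\<lambda>A. 0)"
      using False assms(1)[of _ U] Suc.prems(2) by (intro E_cong) auto
    then show ?thesis using assms(2) p_pos by simp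
  qed
qed

text \<open>Markov's inequality for the \<open>l\<close>-th power, restricted to \<open>\<A>\<close>
  and started from \<open>U = {}\<close>.\<close>

lemma prob_num_edges_ge_le:
  assumes "\<And>A U. A \<in> \<A> \<Longrightarrow> U \<subseteq> A \<Longrightarrow> A \<subseteq> V \<Longrightarrow> card U \<le> k * l \<Longrightarrow> cond_mean U \<le> \<beta>"
    and "0 \<le> \<beta>" and "0 < y"
  shows "measure_pmf.prob M {A. A \<in> \<A> \<and> y \<le> real (num_edges A)} \<le> (\<beta> / y) ^ l"
proof -
  have "y ^ l * E (\<lambda>A. of_bool (A \<in> \<A> \<and> y \<le> real (num_edges A))) =
      E (\<lambda>A. y ^ l * of_bool (A \<in> \<A> \<and> y \<le> real (num_edges A)))"
    by simp
  also have "\<dots> \<le> E (\<lambda>A. real (num_edges A) ^ l * of_bool (A \<in> \<A> \<and> {} \<subseteq> A))"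
    using assms(3) by (intro E_mono) (auto intro: power_mono)
  also have "\<dots> \<le> \<beta> ^ l * p ^ card ({} :: 'a set)"
    using assms by (intro moment_superset_le) auto
  finally show ?thesis
    using assms(3) by (simp add: E_of_bool power_divide field_simps)
qed

section \<open>Degree and codegree bounds for the conditional mean\<close>

lemma card_meeting_le:
  assumes "U \<subseteq> V"
  shows "card {T \<in> H. T \<inter> U \<noteq> {}} \<le> card U * \<Delta>"
proof -
  have "{T \<in> H. T \<inter> U \<noteq> {}} = (\<Union>v\<in>U. {T \<in> H. v \<in> T})" by auto
  moreover have "card (\<Union>v\<in>U. {T \<in> H. v \<in> T}) \<le> (\<Sum>v\<in>U. card {T \<in> H. v \<in> T})"
    using assms finite_V finite_subset by (intro card_UN_le) auto
  moreover have "\<dots> \<le> (\<Sum>v\<in>U. \<Delta>)"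
    using assms degree_le by (intro sum_mono) auto
  ultimately show ?thesis by simp
qed

lemma card_meeting_twice_le:
  assumes "finite U"
  shows "card {T \<in> H. 2 \<le> card (T \<inter> U)} \<le> (card U)\<^sup>2 * \<kappa>"
proof -
  let ?D = "{(x, y). x \<in> U \<and> y \<in> U \<and> x \<noteq> y}"
  have D: "?D \<subseteq> U \<times> U" by auto
  then have fin: "finite ?D" using assms finite_subset by blast
  have "{T \<in> H. 2 \<le> card (T \<inter> U)} \<subseteq> (\<Union>(x, y)\<in>?D. {T \<in> H. x \<in> T \<and> y \<in> T})"
  proof
    fix T assume T: "T \<in> {T \<in> H. 2 \<le> card (T \<inter> U)}"
    then obtain x y where "x \<in> T \<inter> U" "y \<in> T \<inter> U" "x \<noteq> y"
      by (smt (verit, best) card_le_Suc0_iff_eq mem_Collect_eq not_less_eq_eq numeral_2_eq_2 assms finite_Int)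
    then show "T \<in> (\<Union>(x, y)\<in>?D. {T \<in> H. x \<in> T \<and> y \<in> T})" using T by blast
  qed
  then have "card {T \<in> H. 2 \<le> card (T \<inter> U)} \<le> card (\<Union>(x, y)\<in>?D. {T \<in> H. x \<in> T \<and> y \<in> T})"
    using fin finite_H by (intro card_mono finite_UN_I) auto
  also have "\<dots> \<le> (\<Sum>(x, y)\<in>?D. card {T \<in> H. x \<in> T \<and> y \<in> T})"
    using card_UN_le[OF fin, of "\<lambda>(x, y). {T \<in> H. x \<in> T \<and> y \<in> T}"]
    by (simp add: case_prod_unfold)
  also have "\<dots> \<le> (\<Sum>(x, y)\<in>?D. \<kappa>)"
    using codegree_le by (intro sum_mono) auto
  also have "\<dots> = card ?D * \<kappa>" by simp
  also have "\<dots> \<le> card (U \<times> U) * \<kappa>"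
    using D assms by (intro mult_right_mono card_mono) auto
  finally show ?thesis by (simp add: card_cartesian_product power2_eq_square)
qed

lemma power_le_p: "1 \<le> i \<Longrightarrow> p ^ i \<le> p"
  using power_decreasing[of 1 i p] p_pos p_le_1 by simp

text \<open>Edges are sorted by their intersection with \<open>U\<close>: no vertex, one vertex, at
  least two but not all, all. Their weights are \<open>p ^ k\<close>, \<open>p ^ (k - 1)\<close>, at
  most \<open>p\<close>, and 1.\<close>

lemma cond_mean_le:
  assumes "U \<subseteq> V"
  shows "cond_mean U \<le> real (card H) * p ^ k + real (card U) * real \<Delta> * p ^ (k - 1)
    + real \<kappa> * (real (card U))\<^sup>2 * p + real (num_edges U)"
proof -
  have finU: "finite U" using assms finite_V finite_subset by blast
  have "p ^ card (T - U) \<le> p ^ k + of_bool (T \<inter> U \<noteq> {}) * p ^ (k - 1)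
      + of_bool (2 \<le> card (T \<inter> U)) * p + of_bool (T \<subseteq> U)" if T: "T \<in> H" for T
  proof -
    have c: "card (T - U) = k - card (T \<inter> U)"
      using card_edge[OF T] finite_edge[OF T] by (simp add: card_Diff_subset_Int)
    consider "T \<inter> U = {}" | "card (T \<inter> U) = 1" | "2 \<le> card (T \<inter> U)" "\<not> T \<subseteq> U" | "T \<subseteq> U"
      using finite_edge[OF T] by (metis One_nat_def Suc_1 card_0_eq finite_Int less_Suc0 linorder_not_le not_less_eq_eq nle_le)
    then show ?thesis
    proof cases
      case 1 then show ?thesis using c p_pos by simp
    next
      case 2 then show ?thesis using c p_pos by auto
    next
      case 3
      then have "T - U \<noteq> {}" by auto
      then have "1 \<le> card (T - U)" using finite_edge[OF T] by (simp add: Suc_le_eq card_gt_0_iff)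
      then show ?thesis using power_le_p[of "card (T - U)"] 3 p_pos
        by (auto simp: add_nonneg_nonneg intro: add_increasing)
    next
      case 4
      then have "p ^ card (T - U) = 1" by (simp add: Diff_eq_empty_iff[THEN iffD2])
      then show ?thesis using 4 p_pos by auto
    qed
  qed
  then have "cond_mean U \<le> (\<Sum>T\<in>H. p ^ k + of_bool (T \<inter> U \<noteq> {}) * p ^ (k - 1)
      + of_bool (2 \<le> card (T \<inter> U)) * p + of_bool (T \<subseteq> U))"
    unfolding cond_mean_def by (rule sum_mono)
  also have "\<dots> = real (card H) * p ^ k + real (card {T \<in> H. T \<inter> U \<noteq> {}}) * p ^ (k - 1)
      + real (card {T \<in> H. 2 \<le> card (T \<inter> U)}) * p + real (num_edges U)"
    using finite_H by (simp add: sum.distrib num_edges_sum Int_def flip: sum_distrib_right)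
  also have "\<dots> \<le> real (card H) * p ^ k + real (card U * \<Delta>) * p ^ (k - 1)
      + real ((card U)\<^sup>2 * \<kappa>) * p + real (num_edges U)"
    using card_meeting_le[OF assms] card_meeting_twice_le[OF finU] p_pos
    by (intro add_mono mult_right_mono order_refl) (auto simp only: of_nat_le_iff zero_le_power less_imp_le)
  finally show ?thesis by (simp add: mult_ac)
qed

end

section \<open>Disjoint stars\<close>

text \<open>The single term \<open>d ^ d / fact d\<close> of the exponential series gives
  \<open>d ^ d \<le> exp 1 ^ d * fact d\<close>, which replaces Stirling's formula.\<close>

lemma binomial_le_exp_power:
  fixes n d :: nat
  assumes "0 < d"
  shows "real (n choose d) \<le> (exp 1 * real n / real d) ^ d"
proof -
  have "(\<Sum>i\<in>{d}. real d ^ i /\<^sub>R fact i) \<le> (\<Sum>i. real d ^ i /\<^sub>R fact i)"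
    by (intro sum_le_suminf summable_exp_generic) auto
  then have "real d ^ d / fact d \<le> exp (real d)"
    unfolding exp_def by (simp add: field_simps)
  then have 1: "real d ^ d \<le> exp 1 ^ d * fact d"
    by (simp add: field_simps flip: exp_of_nat_mult)
  have "real (n choose d) * fact d \<le> real n ^ d"
    using binomial_fact_pow[of n d] by (metis of_nat_fact of_nat_le_iff of_nat_mult of_nat_power)
  then have "real (n choose d) * fact d * real d ^ d \<le> real n ^ d * (exp 1 ^ d * fact d)"
    using 1 by (intro mult_mono) auto
  then have "(real (n choose d) * real d ^ d) * fact d \<le> (exp 1 * real n) ^ d * fact d"
    by (simp only: power_mult_distrib mult_ac)
  then have "real (n choose d) * real d ^ d \<le> (exp 1 * real n) ^ d"
    by (rule mult_right_le_imp_le) simp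
  then show ?thesis
    using assms by (simp add: power_divide pos_le_divide_eq)
qed

context binomial_hypergraph
begin

text \<open>A sunflower with \<open>d\<close> petals and a one-vertex kernel. The petals share no
  vertices, so the cost of containing a star is linear in \<open>d\<close>.\<close>

definition star :: "nat \<Rightarrow> 'a set set \<Rightarrow> bool" where
  "star d F \<longleftrightarrow> F \<subseteq> H \<and> card F = d \<and>
    (\<exists>v\<in>V. (\<forall>S\<in>F. v \<in> S) \<and> (\<forall>S\<in>F. \<forall>T\<in>F. S \<noteq> T \<longrightarrow> S \<inter> T = {v}))"

definition disjoint_stars :: "nat \<Rightarrow> nat \<Rightarrow> 'a set \<Rightarrow> 'a set set set \<Rightarrow> bool" where
  "disjoint_stars d r A \<F> \<longleftrightarrow> card \<F> = r \<and> (\<forall>F\<in>\<F>. star d F \<and> \<Union>F \<subseteq> A) \<and>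
    (\<forall>F\<in>\<F>. \<forall>G\<in>\<F>. F \<noteq> G \<longrightarrow> \<Union>F \<inter> \<Union>G = {})"

lemma card_Union_le:
  assumes "F \<subseteq> H"
  shows "card (\<Union>F) \<le> card F * k"
proof -
  have "card (\<Union>F) \<le> sum card F"
    using assms finite_edge by (intro card_Union_le_sum_card)
  also have "\<dots> = (\<Sum>S\<in>F. k)" using assms card_edge by (intro sum.cong) auto
  finally show ?thesis by simp
qed

lemma card_Union_star_ge:
  assumes "star d F"
  shows "d * (k - 1) \<le> card (\<Union>F)"
proof -
  obtain v where F: "F \<subseteq> H" "card F = d" "\<forall>S\<in>F. v \<in> S"
    "\<forall>S\<in>F. \<forall>T\<in>F. S \<noteq> T \<longrightarrow> S \<inter> T = {v}"
    using assms unfolding star_def by blast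
  have fin: "finite F" "\<And>S. S \<in> F \<Longrightarrow> finite S"
    using F(1) finite_H finite_subset finite_edge by blast+
  have "d * (k - 1) = (\<Sum>S\<in>F. card (S - {v}))"
    using F card_edge by (simp add: subset_iff)
  also have "\<dots> = card (\<Union>S\<in>F. S - {v})"
    using fin F(4) by (subst card_UN_disjoint) auto
  also have "\<dots> \<le> card (\<Union>F)"
    using fin by (intro card_mono) auto
  finally show ?thesis .
qed

lemma finite_stars: "finite {F. star d F}"
  by (rule finite_subset[of _ "Pow H"]) (auto simp: star_def finite_H)

lemma card_stars_le: "card {F. star d F} \<le> card V * (\<Delta> choose d)"
proof -
  have "{F. star d F} \<subseteq> (\<Union>v\<in>V. {F. F \<subseteq> {S \<in> H. v \<in> S} \<and> card F = d})"
    unfolding star_def by blast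
  moreover have "finite {F. F \<subseteq> {S \<in> H. v \<in> S} \<and> card F = d}" for v
    by (rule finite_subset[of _ "Pow H"]) (auto simp: finite_H)
  ultimately have "card {F. star d F} \<le> card (\<Union>v\<in>V. {F. F \<subseteq> {S \<in> H. v \<in> S} \<and> card F = d})"
    using finite_V by (intro card_mono) auto
  also have "\<dots> \<le> (\<Sum>v\<in>V. card {F. F \<subseteq> {S \<in> H. v \<in> S} \<and> card F = d})"
    using finite_V by (rule card_UN_le)
  also have "\<dots> \<le> (\<Sum>v\<in>V. \<Delta> choose d)"
    using finite_H degree_le by (intro sum_mono) (auto simp: n_subsets intro!: binomial_right_mono)
  finally show ?thesis by simp
qed

text \<open>Union bound over families of \<open>r\<close> stars. Disjointness makes the vertex
  counts add up, so the bound for one star is raised to the power \<open>r\<close>; the gain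
  \<open>fact r\<close> from unordered families is given away.\<close>

lemma prob_disjoint_stars_le:
  "measure_pmf.prob M {A. \<exists>\<F>. disjoint_stars d r A \<F>}
     \<le> (real (card V) * real (\<Delta> choose d) * p ^ (d * (k - 1))) ^ r"
proof -
  let ?C = "{\<F>. \<F> \<subseteq> {F. star d F} \<and> card \<F> = r \<and>
    (\<forall>F\<in>\<F>. \<forall>G\<in>\<F>. F \<noteq> G \<longrightarrow> \<Union>F \<inter> \<Union>G = {})}"
  have sub: "?C \<subseteq> {\<F>. \<F> \<subseteq> {F. star d F} \<and> card \<F> = r}" by auto
  have fin': "finite {\<F>. \<F> \<subseteq> {F. star d F} \<and> card \<F> = r}"
    by (rule finite_subset[of _ "Pow {F. star d F}"]) (auto simp: finite_stars)
  have fin: "finite ?C" using sub fin' finite_subset by blast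
  have cardC: "card ?C \<le> (card V * (\<Delta> choose d)) ^ r"
  proof -
    have "card ?C \<le> card {F. star d F} choose r"
      using card_mono[OF fin' sub] by (simp add: n_subsets finite_stars)
    also have "\<dots> \<le> (card {F. star d F} choose r) * fact r" by simp
    also have "\<dots> \<le> card {F. star d F} ^ r" by (rule binomial_fact_pow)
    also have "\<dots> \<le> (card V * (\<Delta> choose d)) ^ r" by (intro power_mono card_stars_le) simp
    finally show ?thesis .
  qed
  have pw: "measure_pmf.prob M {A. \<Union>(\<Union>\<F>) \<subseteq> A} \<le> p ^ (d * (k - 1) * r)" if \<F>: "\<F> \<in> ?C" for \<F>
  proof -
    have stars: "\<F> \<subseteq> {F. star d F}" "card \<F> = r"
      and disj: "\<And>F G. F \<in> \<F> \<Longrightarrow> G \<in> \<F> \<Longrightarrow> F \<noteq> G \<Longrightarrow> \<Union>F \<inter> \<Union>G = {}"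
      using \<F> by auto
    have V: "\<Union>(\<Union>\<F>) \<subseteq> V"
    proof (intro Union_least)
      fix S assume "S \<in> \<Union>\<F>"
      then have "S \<in> H" using stars(1) by (auto simp: star_def)
      then show "S \<subseteq> V" by (rule edge_subset)
    qed
    have fin\<F>: "finite \<F>" by (rule finite_subset[OF stars(1) finite_stars])
    have finF: "finite (\<Union>F)" if "F \<in> \<F>" for F
    proof -
      have "\<Union>F \<subseteq> V" using V that by blast
      then show ?thesis using finite_V finite_subset by blast
    qed
    have "d * (k - 1) * r = (\<Sum>F\<in>\<F>. d * (k - 1))" using stars(2) by simp
    also have "\<dots> \<le> (\<Sum>F\<in>\<F>. card (\<Union>F))"
      using stars(1) by (intro sum_mono card_Union_star_ge) blast
    also have "\<dots> = card (\<Union>F\<in>\<F>. \<Union>F)"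
      using disj fin\<F> finF by (intro card_UN_disjoint[symmetric]) blast+
    also have "(\<Union>F\<in>\<F>. \<Union>F) = \<Union>(\<Union>\<F>)" by auto
    finally have "p ^ card (\<Union>(\<Union>\<F>)) \<le> p ^ (d * (k - 1) * r)"
      using p_pos p_le_1 by (intro power_decreasing) auto
    then show ?thesis unfolding prob_superset[OF V] .
  qed
  have "measure_pmf.prob M {A. \<exists>\<F>. disjoint_stars d r A \<F>}
      \<le> measure_pmf.prob M (\<Union>\<F>\<in>?C. {A. \<Union>(\<Union>\<F>) \<subseteq> A})"
  proof (rule measure_pmf.finite_measure_mono)
    show "{A. \<exists>\<F>. disjoint_stars d r A \<F>} \<subseteq> (\<Union>\<F>\<in>?C. {A. \<Union>(\<Union>\<F>) \<subseteq> A})"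
    proof
      fix A assume "A \<in> {A. \<exists>\<F>. disjoint_stars d r A \<F>}"
      then obtain \<F> where \<F>: "disjoint_stars d r A \<F>" by blast
      have "\<F> \<in> ?C" using \<F> unfolding disjoint_stars_def by simp blast
      moreover have "\<Union>(\<Union>\<F>) \<subseteq> A"
        by (intro Union_least) (use \<F> in \<open>auto simp: disjoint_stars_def\<close>)
      ultimately show "A \<in> (\<Union>\<F>\<in>?C. {A. \<Union>(\<Union>\<F>) \<subseteq> A})" by (intro UN_I) simp_all
    qed
  qed simp
  also have "\<dots> \<le> (\<Sum>\<F>\<in>?C. measure_pmf.prob M {A. \<Union>(\<Union>\<F>) \<subseteq> A})"
    using fin by (intro measure_pmf.finite_measure_subadditive_finite) auto
  also have "\<dots> \<le> (\<Sum>\<F>\<in>?C. p ^ (d * (k - 1) * r))"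
    by (intro sum_mono pw)
  also have "\<dots> \<le> real ((card V * (\<Delta> choose d)) ^ r) * p ^ (d * (k - 1) * r)"
    using cardC p_pos by (simp only: sum_constant) (intro mult_right_mono, simp_all only: of_nat_le_iff, simp)
  also have "\<dots> = (real (card V) * real (\<Delta> choose d) * p ^ (d * (k - 1))) ^ r"
    by (simp add: power_mult power_mult_distrib)
  finally show ?thesis .
qed

text \<open>Greedy choice: fewer than \<open>d\<close> edges cover at most \<open>d * k\<close>
  vertices, and by the codegree bound at most \<open>d * k * \<kappa>\<close> edges through
  \<open>v\<close> meet these vertices outside \<open>v\<close>. A further edge remains.\<close>

lemma exists_star:
  assumes "v \<in> V" and "J \<subseteq> V" and "d * k * \<kappa> < card {S \<in> H. S \<subseteq> J \<and> v \<in> S}"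
  shows "\<exists>F. star d F \<and> \<Union>F \<subseteq> J"
proof -
  have "\<exists>F \<subseteq> H. card F = j \<and> (\<forall>S\<in>F. v \<in> S \<and> S \<subseteq> J) \<and> (\<forall>S\<in>F. \<forall>T\<in>F. S \<noteq> T \<longrightarrow> S \<inter> T = {v})"
    if "j \<le> d" for j
    using that
  proof (induction j)
    case 0
    then show ?case by (intro exI[of _ "{}"]) auto
  next
    case (Suc j)
    then obtain F where F: "F \<subseteq> H" "card F = j" "\<forall>S\<in>F. v \<in> S \<and> S \<subseteq> J"
      "\<forall>S\<in>F. \<forall>T\<in>F. S \<noteq> T \<longrightarrow> S \<inter> T = {v}" by auto
    have finF: "finite F" using F(1) finite_H finite_subset by blast
    have finU: "finite (\<Union>F)" using F(1) finF finite_edge by blast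
    let ?B = "\<Union>x\<in>\<Union>F - {v}. {T \<in> H. x \<in> T \<and> v \<in> T}"
    have "card ?B \<le> (\<Sum>x\<in>\<Union>F - {v}. card {T \<in> H. x \<in> T \<and> v \<in> T})"
      using finU by (intro card_UN_le) auto
    also have "\<dots> \<le> (\<Sum>x\<in>\<Union>F - {v}. \<kappa>)"
      by (intro sum_mono codegree_le) auto
    also have "\<dots> \<le> card (\<Union>F) * \<kappa>"
      using finU by (auto intro!: mult_right_mono card_mono)
    also have "\<dots> \<le> d * k * \<kappa>"
      using card_Union_le[OF F(1)] F(2) Suc.prems
      by (intro mult_right_mono) (auto intro: order_trans)
    also note assms(3)
    finally have "\<not> {S \<in> H. S \<subseteq> J \<and> v \<in> S} \<subseteq> ?B"
      using finite_H finU card_mono[of ?B] by (fastforce simp: not_le[symmetric])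
    then obtain S where S: "S \<in> H" "S \<subseteq> J" "v \<in> S" "S \<notin> ?B" by blast
    show ?case
    proof (cases "S \<in> F")
      \<comment> \<open>If \<open>S\<close> were already chosen, any vertex of \<open>S\<close>
        other than \<open>v\<close> would put \<open>S\<close> into the excluded set; so
        \<open>S\<close> would be \<open>{v}\<close>.\<close>
      case True
      then have "S - {v} = {}" using S by auto
      then have "card S \<le> card {v}" by (intro card_mono) auto
      then show ?thesis using card_edge[OF S(1)] k_ge_2 by simp
    next
      case False
      have meet: "S \<inter> T = {v}" "T \<inter> S = {v}" if "T \<in> F" for T
        using S F(3) that by auto
      show ?thesis
      proof (intro exI[of _ "insert S F"] conjI)
        show "insert S F \<subseteq> H" using S(1) F(1) by simp
        show "card (insert S F) = Suc j" using False F(2) finF by simp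
        show "\<forall>T\<in>insert S F. v \<in> T \<and> T \<subseteq> J" using S F(3) by simp
        show "\<forall>T\<in>insert S F. \<forall>T'\<in>insert S F. T \<noteq> T' \<longrightarrow> T \<inter> T' = {v}"
          using meet F(4) by simp
      qed
    qed
  qed
  from this[OF order_refl] obtain F where F: "F \<subseteq> H" "card F = d" "\<forall>S\<in>F. v \<in> S \<and> S \<subseteq> J"
    "\<forall>S\<in>F. \<forall>T\<in>F. S \<noteq> T \<longrightarrow> S \<inter> T = {v}" by (elim exE conjE)
  have "star d F" unfolding star_def using F assms(1) by (intro conjI bexI[of _ v]) simp_all
  moreover have "\<Union>F \<subseteq> J" using F(3) by (intro Union_least) simp
  ultimately show ?thesis by (intro exI conjI)
qed

lemma card_edges_meeting_le_sum:
  assumes "finite W" and "I \<subseteq> V" and "\<And>v. v \<in> W \<inter> I \<Longrightarrow> card {S \<in> H. S \<subseteq> I \<and> v \<in> S} \<le> D"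
  shows "card {S \<in> H. S \<subseteq> I \<and> S \<inter> W \<noteq> {}} \<le> card W * D"
proof -
  have "{S \<in> H. S \<subseteq> I \<and> S \<inter> W \<noteq> {}} = (\<Union>v\<in>W \<inter> I. {S \<in> H. S \<subseteq> I \<and> v \<in> S})" by auto
  also have "card \<dots> \<le> (\<Sum>v\<in>W \<inter> I. card {S \<in> H. S \<subseteq> I \<and> v \<in> S})"
    using assms(1) by (intro card_UN_le) auto
  also have "\<dots> \<le> (\<Sum>v\<in>W \<inter> I. D)" using assms(3) by (intro sum_mono) auto
  also have "\<dots> \<le> card W * D" using assms(1) by (auto intro!: mult_right_mono card_mono)
  finally show ?thesis .
qed

text \<open>If fewer than \<^term>\<open>R\<close> disjoint stars of size \<^term>\<open>d\<close> can be found, then a maximal such family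
  covers few vertices, each of small degree, and all degrees outside are small too.\<close>

lemma num_edges_le_of_no_stars:
  assumes "A \<subseteq> V" and "I \<subseteq> A" and "0 < d" and "0 < R"
    and no: "\<nexists>\<F>. disjoint_stars d R A \<F>"
    and no2: "2 \<le> R \<Longrightarrow> \<nexists>\<F>. disjoint_stars d' 1 A \<F>"
  shows "num_edges I \<le> k * \<kappa> * d * card I + (R - 1) * d * d' * k\<^sup>2 * \<kappa>"
proof (rule ccontr)
  assume contr: "\<not> ?thesis"
  have IV: "I \<subseteq> V" using assms by auto
  have finI: "finite I" using IV finite_V finite_subset by blast
  \<comment> \<open>Too many edges allow stars to be collected one by one until \<open>R\<close> of
    them contradict \<open>no\<close>.\<close>
  have "\<exists>\<F>. disjoint_stars d r I \<F>" if "r \<le> R" for r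
    using that
  proof (induction r)
    case 0
    then show ?case by (intro exI[of _ "{}"]) (auto simp: disjoint_stars_def)
  next
    case (Suc r)
    then obtain \<F> where \<F>: "card \<F> = r" "\<And>F. F \<in> \<F> \<Longrightarrow> star d F" "\<And>F. F \<in> \<F> \<Longrightarrow> \<Union>F \<subseteq> I"
      "\<And>F G. F \<in> \<F> \<Longrightarrow> G \<in> \<F> \<Longrightarrow> F \<noteq> G \<Longrightarrow> \<Union>F \<inter> \<Union>G = {}"
      by (auto simp: disjoint_stars_def)
    have fin\<F>: "finite \<F>" using \<F>(2) finite_stars finite_subset
      by (metis (mono_tags, lifting) mem_Collect_eq subsetI)
    define W where "W = \<Union>(\<Union>\<F>)"
    have WI: "W \<subseteq> I"
      unfolding W_def by (intro Union_least) (use \<F>(3) in blast)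
    have finW: "finite W" using WI finI finite_subset by blast
    have "card W \<le> (\<Sum>F\<in>\<F>. card (\<Union>F))"
    proof -
      have "W = (\<Union>F\<in>\<F>. \<Union>F)" unfolding W_def by blast
      then show ?thesis using card_UN_le[OF fin\<F>, of Union] by (simp only:)
    qed
    also have "\<dots> \<le> (\<Sum>F\<in>\<F>. d * k)"
    proof (rule sum_mono)
      fix F assume "F \<in> \<F>"
      then have "F \<subseteq> H" "card F = d" using \<F>(2) by (auto simp: star_def)
      then show "card (\<Union>F) \<le> d * k" using card_Union_le by blast
    qed
    also have "\<dots> = r * d * k" using \<F>(1) by simp
    also have "\<dots> \<le> (R - 1) * d * k"
      using Suc.prems by (intro mult_right_mono) auto
    finally have cW: "card W \<le> (R - 1) * d * k" .
    have meet: "card {S \<in> H. S \<subseteq> I \<and> S \<inter> W \<noteq> {}} \<le> (R - 1) * d * d' * k\<^sup>2 * \<kappa>"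
    proof (cases "2 \<le> R")
      case True
      have "card {S \<in> H. S \<subseteq> I \<and> v \<in> S} \<le> d' * k * \<kappa>" if "v \<in> W \<inter> I" for v
      proof (rule ccontr)
        assume "\<not> ?thesis"
        then have deg: "d' * k * \<kappa> < card {S \<in> H. S \<subseteq> I \<and> v \<in> S}" by simp
        have "v \<in> V" using that IV by auto
        from exists_star[OF this IV deg] obtain F where "star d' F" "\<Union>F \<subseteq> I"
          by (elim exE conjE)
        then have "disjoint_stars d' 1 A {F}" using assms(2) by (auto simp: disjoint_stars_def)
        then show False using no2[OF True] by blast
      qed
      then have "card {S \<in> H. S \<subseteq> I \<and> S \<inter> W \<noteq> {}} \<le> card W * (d' * k * \<kappa>)"
        using finW IV by (intro card_edges_meeting_le_sum) auto
      also have "\<dots> \<le> (R - 1) * d * k * (d' * k * \<kappa>)" using cW by (intro mult_right_mono) auto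
      finally show ?thesis by (simp add: mult_ac power2_eq_square)
    next
      \<comment> \<open>For \<open>R = 1\<close> the family is still empty, so there are no covered
        vertices whose degree must be capped. This is why \<open>no2\<close> is asked only for
        \<open>2 \<le> R\<close>.\<close>
      case False
      then have "W = {}" using cW finW by auto
      then show ?thesis by simp
    qed
    have "card {S \<in> H. S \<subseteq> I} \<le> card {S \<in> H. S \<subseteq> I - W} + card {S \<in> H. S \<subseteq> I \<and> S \<inter> W \<noteq> {}}"
    proof -
      have "{S \<in> H. S \<subseteq> I} \<subseteq> {S \<in> H. S \<subseteq> I - W} \<union> {S \<in> H. S \<subseteq> I \<and> S \<inter> W \<noteq> {}}" by blast
      then have "card {S \<in> H. S \<subseteq> I}
          \<le> card ({S \<in> H. S \<subseteq> I - W} \<union> {S \<in> H. S \<subseteq> I \<and> S \<inter> W \<noteq> {}})"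
        using finite_H by (intro card_mono) simp_all
      also have "\<dots> \<le> card {S \<in> H. S \<subseteq> I - W} + card {S \<in> H. S \<subseteq> I \<and> S \<inter> W \<noteq> {}}"
        by (rule card_Un_le)
      finally show ?thesis .
    qed
    then have many: "k * \<kappa> * d * card I < card {S \<in> H. S \<subseteq> I - W}"
      using contr meet unfolding num_edges_def by linarith
    \<comment> \<open>Averaging over the vertices of \<open>I - W\<close>: small degrees everywhere
      would leave too few edges.\<close>
    have "\<exists>v\<in>I - W. d * k * \<kappa> < card {S \<in> H. S \<subseteq> I - W \<and> v \<in> S}"
    proof (rule ccontr)
      assume "\<not> ?thesis"
      then have "card {S \<in> H. S \<subseteq> I - W \<and> S \<inter> (I - W) \<noteq> {}} \<le> card (I - W) * (d * k * \<kappa>)"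
        using finI IV by (intro card_edges_meeting_le_sum) (auto simp: not_less)
      also have "\<dots> \<le> card I * (d * k * \<kappa>)"
        using finI by (intro mult_right_mono card_mono) auto
      also have "{S \<in> H. S \<subseteq> I - W \<and> S \<inter> (I - W) \<noteq> {}} = {S \<in> H. S \<subseteq> I - W}"
      proof -
        have "S \<noteq> {}" if "S \<in> H" for S using card_edge[OF that] k_ge_2 by auto
        then show ?thesis by (auto simp: Int_absorb2)
      qed
      finally show False using many by (simp add: mult_ac)
    qed
    then obtain v where v: "v \<in> I - W" "d * k * \<kappa> < card {S \<in> H. S \<subseteq> I - W \<and> v \<in> S}"
      by blast
    have "v \<in> V" "I - W \<subseteq> V" using v IV by auto
    from exists_star[OF this v(2)] obtain F where F: "star d F" "\<Union>F \<subseteq> I - W"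
      by (elim exE conjE)
    \<comment> \<open>\<open>0 < d\<close> excludes the empty star; the new star has vertices
      outside \<open>W\<close> and therefore enlarges the family.\<close>
    have "F \<noteq> {}" using F(1) \<open>0 < d\<close> by (auto simp: star_def)
    then obtain S where S: "S \<in> F" by blast
    then have "card S = k" using F(1) by (intro card_edge) (auto simp: star_def)
    then have "S \<noteq> {}" using k_ge_2 by auto
    have "F \<notin> \<F>"
    proof
      assume "F \<in> \<F>"
      then have "S \<subseteq> W" using S unfolding W_def by blast
      moreover have "S \<subseteq> I - W" using S F(2) by blast
      ultimately show False using \<open>S \<noteq> {}\<close> by blast
    qed
    then have "disjoint_stars d (Suc r) I (insert F \<F>)"
    proof -
      have "\<Union>F \<inter> \<Union>G = {} \<and> \<Union>G \<inter> \<Union>F = {}" if "G \<in> \<F>" for G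
      proof -
        have "\<Union>G \<subseteq> W" using that unfolding W_def by blast
        then show ?thesis using F(2) by blast
      qed
      moreover have "card (insert F \<F>) = Suc r" using \<F>(1) fin\<F> \<open>F \<notin> \<F>\<close> by simp
      moreover have "\<Union>F \<subseteq> I" using F(2) by blast
      ultimately show ?thesis
        unfolding disjoint_stars_def using \<F>(2-4) F(1) by simp
    qed
    then show ?case by blast
  qed
  from this[of R] obtain \<F> where "disjoint_stars d R I \<F>" by auto
  then have "disjoint_stars d R A \<F>"
    using assms(2) unfolding disjoint_stars_def by (meson subset_trans)
  then show False using no by blast
qed

end

section \<open>A Poisson-type lower bound\<close>

context binomial_hypergraph
begin

lemma num_edges_Un_ge:
  assumes "S \<in> H" and "\<not> S \<subseteq> U"
  shows "num_edges U + 1 \<le> num_edges (U \<union> S)"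
proof -
  have "insert S {T \<in> H. T \<subseteq> U} \<subseteq> {T \<in> H. T \<subseteq> U \<union> S}" using assms by auto
  then have "card (insert S {T \<in> H. T \<subseteq> U}) \<le> card {T \<in> H. T \<subseteq> U \<union> S}"
    using finite_H by (intro card_mono) auto
  then show ?thesis using assms finite_H by (simp add: num_edges_def)
qed

text \<open>Counterpart of \<open>moment_superset_le\<close>: only edges that are new and raise the
  conditional mean by at most 2 are kept, and they are at least half of \<open>H\<close>. The budget
  \<open>cond_mean U + 2 * j \<le> s / 2\<close> survives each step. The condition
  \<open>num_edges U + j \<le> num_edges A\<close> records that \<open>j\<close> new edges were
  added.\<close>

lemma moment_superset_ge:
  assumes good: "\<And>U. U \<subseteq> V \<Longrightarrow> card U \<le> k * t \<Longrightarrow>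
      real (card H) / 2 \<le> real (card {S \<in> H. \<not> S \<subseteq> U \<and> cond_mean (U \<union> S) \<le> cond_mean U + 2})"
    and "0 < s" and "U \<subseteq> V" and "card U + k * j \<le> k * t"
    and "cond_mean U + 2 * real j \<le> s / 2"
  shows "(real (card H) / 2) ^ j * p ^ (card U + k * j) / 2
    \<le> E (\<lambda>A. real (num_edges A) ^ j *
          of_bool (num_edges U + j \<le> num_edges A \<and> real (num_edges A) \<le> s \<and> U \<subseteq> A))"
  using assms(3-)
proof (induction j arbitrary: U)
  case 0
  \<comment> \<open>Markov's inequality given \<open>U\<close>: having more than \<open>s\<close>
    edges costs at most the fraction \<open>cond_mean U / s\<close>, which is at most 1/2.\<close>
  have "p ^ card U - p ^ card U * cond_mean U / s =
      E (\<lambda>A. of_bool (U \<subseteq> A) - real (num_edges A) * of_bool (U \<subseteq> A) / s)"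
    using E_superset[OF 0(1)] E_num_edges_superset[OF 0(1)] by simp
  also have "\<dots> \<le> E (\<lambda>A. real (num_edges A) ^ 0 *
      of_bool (num_edges U + 0 \<le> num_edges A \<and> real (num_edges A) \<le> s \<and> U \<subseteq> A))"
  proof (rule E_mono)
    fix A assume "A \<subseteq> V"
    have "num_edges U \<le> num_edges A" if "U \<subseteq> A"
      unfolding num_edges_def using that finite_H by (intro card_mono) auto
    then show "of_bool (U \<subseteq> A) - real (num_edges A) * of_bool (U \<subseteq> A) / s
      \<le> real (num_edges A) ^ 0 *
        of_bool (num_edges U + 0 \<le> num_edges A \<and> real (num_edges A) \<le> s \<and> U \<subseteq> A)"
      using \<open>0 < s\<close> by (auto simp: field_simps)
  qed
  finally have 1: "p ^ card U - p ^ card U * cond_mean U / s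
    \<le> E (\<lambda>A. real (num_edges A) ^ 0 *
      of_bool (num_edges U + 0 \<le> num_edges A \<and> real (num_edges A) \<le> s \<and> U \<subseteq> A))" .
  have "cond_mean U / s \<le> 1 / 2" using 0(3) \<open>0 < s\<close> by (simp add: field_simps)
  then have "p ^ card U * (cond_mean U / s) \<le> p ^ card U * (1 / 2)"
    using p_pos by (intro mult_left_mono) auto
  then show ?case using 1 by simp
next
  case (Suc j)
  define G where "G = {S \<in> H. \<not> S \<subseteq> U \<and> cond_mean (U \<union> S) \<le> cond_mean U + 2}"
  let ?f = "\<lambda>U j A. real (num_edges A) ^ j *
    of_bool (num_edges U + j \<le> num_edges A \<and> real (num_edges A) \<le> s \<and> U \<subseteq> A)"
  let ?c = "(real (card H) / 2) ^ j * p ^ (card U + k + k * j) / 2"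
  have "real (card H) / 2 \<le> real (card G)"
    unfolding G_def using Suc.prems(1,2) by (intro good) auto
  then have "(real (card H) / 2) * ?c \<le> real (card G) * ?c"
    using p_pos by (intro mult_right_mono) auto
  also have "\<dots> = (\<Sum>S\<in>G. ?c)" by simp
  also have "\<dots> \<le> (\<Sum>S\<in>G. E (?f (U \<union> S) j))"
  proof (rule sum_mono)
    fix S assume "S \<in> G"
    then have S: "S \<in> H" "cond_mean (U \<union> S) \<le> cond_mean U + 2" by (auto simp: G_def)
    have c: "card (U \<union> S) \<le> card U + k" using card_Un_le[of U S] card_edge[OF S(1)] by simp
    have "?c \<le> (real (card H) / 2) ^ j * p ^ (card (U \<union> S) + k * j) / 2"
      using c p_pos p_le_1 by (intro divide_right_mono mult_left_mono power_decreasing) auto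
    also have "\<dots> \<le> E (?f (U \<union> S) j)"
      using Suc.prems S c edge_subset[OF S(1)] by (intro Suc.IH) auto
    finally show "?c \<le> E (?f (U \<union> S) j)" .
  qed
  also have "\<dots> = E (\<lambda>A. \<Sum>S\<in>G. ?f (U \<union> S) j A)" by (rule E_sum[symmetric])
  also have "\<dots> \<le> E (?f U (Suc j))"
  proof (rule E_mono)
    fix A assume "A \<subseteq> V"
    \<comment> \<open>Because \<open>S\<close> is not inside \<open>U\<close>, the count for
      \<open>U \<union> S\<close> exceeds that for \<open>U\<close>; so the condition with
      \<open>j\<close> over \<open>U \<union> S\<close> gives the one with \<open>Suc j\<close> over
      \<open>U\<close>.\<close>
    have "(\<Sum>S\<in>G. ?f (U \<union> S) j A) \<le> (\<Sum>S\<in>G. of_bool (S \<subseteq> A) * ?f U j A *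
        of_bool (num_edges U + Suc j \<le> num_edges A))"
    proof (rule sum_mono)
      fix S assume "S \<in> G"
      then have "num_edges U + 1 \<le> num_edges (U \<union> S)"
        by (intro num_edges_Un_ge) (auto simp: G_def)
      then show "?f (U \<union> S) j A \<le> of_bool (S \<subseteq> A) * ?f U j A *
          of_bool (num_edges U + Suc j \<le> num_edges A)"
        by auto
    qed
    also have "\<dots> \<le> (\<Sum>S\<in>H. of_bool (S \<subseteq> A) * ?f U j A *
        of_bool (num_edges U + Suc j \<le> num_edges A))"
      using finite_H by (intro sum_mono2) (auto simp: G_def)
    also have "\<dots> = real (num_edges A) * (?f U j A * of_bool (num_edges U + Suc j \<le> num_edges A))"
      by (simp only: num_edges_sum sum_distrib_right mult.assoc)
    also have "\<dots> \<le> ?f U (Suc j) A" by auto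
    finally show "(\<Sum>S\<in>G. ?f (U \<union> S) j A) \<le> ?f U (Suc j) A" .
  qed
  finally show ?case by (simp add: add_ac mult_ac)
qed

text \<open>On the truncated event the \<open>t\<close>-th power is at most \<open>s ^ t\<close>, so
  a lower bound for the moment divided by \<open>s ^ t\<close> bounds the probability from
  below.\<close>

lemma prob_num_edges_ge_ge:
  assumes good: "\<And>U. U \<subseteq> V \<Longrightarrow> card U \<le> k * t \<Longrightarrow>
      real (card H) / 2 \<le> real (card {S \<in> H. \<not> S \<subseteq> U \<and> cond_mean (U \<union> S) \<le> cond_mean U + 2})"
    and t: "0 < t" "real (card H) * p ^ k \<le> real t"
  shows "(real (card H) * p ^ k / (12 * real t)) ^ t / 2 \<le> measure_pmf.prob M {A. t \<le> num_edges A}"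
proof -
  \<comment> \<open>The initial mean is at most \<open>t\<close> and \<open>t\<close> steps add at
    most \<open>2 * t\<close>, so \<open>s / 2 = 3 * t\<close> suffices. The constant 12 is this 6
    times the 2 from keeping half of the edges.\<close>
  define s where "s = 6 * real t"
  have s: "0 < s" using t by (simp add: s_def)
  have "(real (card H) / 2) ^ t * p ^ (card ({} :: 'a set) + k * t) / 2
    \<le> E (\<lambda>A. real (num_edges A) ^ t *
          of_bool (num_edges {} + t \<le> num_edges A \<and> real (num_edges A) \<le> s \<and> {} \<subseteq> A))"
    using t s by (intro moment_superset_ge[OF good]) (auto simp: s_def cond_mean_empty)
  also have "\<dots> \<le> E (\<lambda>A. s ^ t * of_bool (t \<le> num_edges A))"
    using s by (intro E_mono) (auto intro: power_mono)
  also have "\<dots> = s ^ t * measure_pmf.prob M {A. t \<le> num_edges A}"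
    by (simp add: E_of_bool)
  finally have "((real (card H) / 2) ^ t * p ^ (k * t) / 2) / s ^ t \<le> measure_pmf.prob M {A. t \<le> num_edges A}"
    using s by (simp add: divide_le_eq mult_ac)
  moreover have "(real (card H) * p ^ k / (12 * real t)) ^ t = ((real (card H) / 2) * p ^ k / s) ^ t"
    by (simp add: s_def)
  moreover have "\<dots> = (real (card H) / 2) ^ t * p ^ (k * t) / s ^ t"
    by (simp only: power_mult power_mult_distrib power_divide)
  ultimately show ?thesis by simp
qed

text \<open>Such a \<open>T\<close> has a vertex in \<open>U\<close>, since otherwise it would equal
  \<open>S\<close>. Either it has two vertices there, or only one and then at least
  \<open>k - 1 \<ge> 2\<close> in \<open>S\<close>; here \<open>3 \<le> k\<close> enters. Each kind
  is counted by summing over \<open>T\<close> first.\<close>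

lemma card_pairs_in_Un_le:
  assumes "3 \<le> k" and "U \<subseteq> V"
  shows "(\<Sum>S\<in>H. card {T \<in> H. T \<subseteq> U \<union> S \<and> T \<noteq> S \<and> T \<inter> S \<noteq> {}})
    \<le> \<kappa> * (card U)\<^sup>2 * (k * \<Delta>) + card U * \<Delta> * (k\<^sup>2 * \<kappa>)"
proof -
  have finU: "finite U" using assms finite_V finite_subset by blast
  let ?T2 = "{T \<in> H. 2 \<le> card (T \<inter> U)}" and ?T1 = "{T \<in> H. T \<inter> U \<noteq> {}}"
  have "{T \<in> H. T \<subseteq> U \<union> S \<and> T \<noteq> S \<and> T \<inter> S \<noteq> {}}
      \<subseteq> {T \<in> ?T2. T \<inter> S \<noteq> {}} \<union> {T \<in> ?T1. 2 \<le> card (S \<inter> T)}" if S: "S \<in> H" for S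
  proof
    fix T assume "T \<in> {T \<in> H. T \<subseteq> U \<union> S \<and> T \<noteq> S \<and> T \<inter> S \<noteq> {}}"
    then have T: "T \<in> H" "T \<subseteq> U \<union> S" "T \<noteq> S" "T \<inter> S \<noteq> {}" by auto
    have "T \<inter> U \<noteq> {}"
    proof
      assume "T \<inter> U = {}"
      then have "T \<subseteq> S" using T by auto
      then show False using card_subset_eq[OF finite_edge[OF S]] card_edge[OF S] card_edge[OF T(1)] T(3) by simp
    qed
    moreover have "2 \<le> card (S \<inter> T)" if "\<not> 2 \<le> card (T \<inter> U)"
    proof -
      have "(T \<inter> U) \<union> (S \<inter> T) = T" using T(2) by blast
      then have "k = card ((T \<inter> U) \<union> (S \<inter> T))" using card_edge[OF T(1)] by simp
      also have "\<dots> \<le> card (T \<inter> U) + card (S \<inter> T)" by (rule card_Un_le)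
      finally show ?thesis using that assms(1) by simp
    qed
    ultimately show "T \<in> {T \<in> ?T2. T \<inter> S \<noteq> {}} \<union> {T \<in> ?T1. 2 \<le> card (S \<inter> T)}"
      using T by blast
  qed
  then have "card {T \<in> H. T \<subseteq> U \<union> S \<and> T \<noteq> S \<and> T \<inter> S \<noteq> {}}
      \<le> card ({T \<in> ?T2. T \<inter> S \<noteq> {}} \<union> {T \<in> ?T1. 2 \<le> card (S \<inter> T)})" if "S \<in> H" for S
    using that finite_H by (intro card_mono) auto
  then have "(\<Sum>S\<in>H. card {T \<in> H. T \<subseteq> U \<union> S \<and> T \<noteq> S \<and> T \<inter> S \<noteq> {}})
      \<le> (\<Sum>S\<in>H. card {T \<in> ?T2. T \<inter> S \<noteq> {}} + card {T \<in> ?T1. 2 \<le> card (S \<inter> T)})"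
    by (intro sum_mono) (rule order_trans[OF _ card_Un_le])
  also have "\<dots> = (\<Sum>S\<in>H. card {T \<in> ?T2. T \<inter> S \<noteq> {}}) + (\<Sum>S\<in>H. card {T \<in> ?T1. 2 \<le> card (S \<inter> T)})"
    by (rule sum.distrib)
  also have "(\<Sum>S\<in>H. card {T \<in> ?T2. T \<inter> S \<noteq> {}}) = (\<Sum>T\<in>?T2. card {S \<in> H. T \<inter> S \<noteq> {}})"
    using finite_H by (intro sum_multicount_gen) auto
  also have "(\<Sum>S\<in>H. card {T \<in> ?T1. 2 \<le> card (S \<inter> T)}) = (\<Sum>T\<in>?T1. card {S \<in> H. 2 \<le> card (S \<inter> T)})"
    using finite_H by (intro sum_multicount_gen) auto
  also have "(\<Sum>T\<in>?T2. card {S \<in> H. T \<inter> S \<noteq> {}}) \<le> (\<Sum>T\<in>?T2. k * \<Delta>)"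
  proof (rule sum_mono)
    fix T assume "T \<in> ?T2"
    then have "T \<in> H" by simp
    then show "card {S \<in> H. T \<inter> S \<noteq> {}} \<le> k * \<Delta>"
      using card_meeting_le[OF edge_subset] card_edge by (metis (no_types, lifting) Collect_cong Int_commute)
  qed
  also have "\<dots> \<le> \<kappa> * (card U)\<^sup>2 * (k * \<Delta>)"
    using card_meeting_twice_le[OF finU] by (simp add: mult_ac mult_right_mono)
  also have "(\<Sum>T\<in>?T1. card {S \<in> H. 2 \<le> card (S \<inter> T)}) \<le> (\<Sum>T\<in>?T1. k\<^sup>2 * \<kappa>)"
  proof (rule sum_mono)
    fix T assume "T \<in> ?T1"
    then have "T \<in> H" by simp
    then show "card {S \<in> H. 2 \<le> card (S \<inter> T)} \<le> k\<^sup>2 * \<kappa>"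
      using card_meeting_twice_le[OF finite_edge] card_edge by metis
  qed
  also have "\<dots> \<le> card U * \<Delta> * (k\<^sup>2 * \<kappa>)"
    using card_meeting_le[OF assms(2)] by (simp add: mult_right_mono)
  finally show ?thesis by simp
qed

text \<open>Adding \<open>S\<close> raises the mean by 1 for \<open>S\<close> itself plus at most
  \<open>e S\<close>, so \<open>S\<close> fails only if it lies inside \<open>U\<close> or
  \<open>1 < e S\<close>. Two parts of \<open>e S\<close> are at most 1/4 together by
  \<open>p_small\<close>; the third is small on average by \<open>card_pairs_in_Un_le\<close>.
  Failures thus make up at most 1/4 + 1/4 of \<open>H\<close>.\<close>

lemma card_good_edges_ge:
  assumes "3 \<le> k" and "U \<subseteq> V"
    and p_small: "real k * real \<Delta> * p ^ (k - 1) + real \<kappa> * (real (card U) + real k)\<^sup>2 * p \<le> 1 / 4"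
    and H_large: "real \<kappa> * (real (card U))\<^sup>2 * (1 + real k * real \<Delta>)
      + real (card U) * real \<Delta> * ((real k)\<^sup>2 * real \<kappa>) \<le> real (card H) / 4"
  shows "real (card H) / 2 \<le> real (card {S \<in> H. \<not> S \<subseteq> U \<and> cond_mean (U \<union> S) \<le> cond_mean U + 2})"
proof -
  have finU: "finite U" using assms finite_V finite_subset by blast
  let ?P = "\<lambda>S T. T \<subseteq> U \<union> S \<and> T \<noteq> S \<and> T \<inter> S \<noteq> {}"
  define e where "e S = (\<Sum>T\<in>H. of_bool (T \<inter> S \<noteq> {}) * p ^ (k - 1)
    + of_bool (2 \<le> card (T \<inter> (U \<union> S))) * p + of_bool (?P S T))" for S
  have e_nonneg: "0 \<le> e S" for S unfolding e_def using p_pos by (intro sum_nonneg) simp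
  have step: "cond_mean (U \<union> S) \<le> cond_mean U + 1 + e S" if S: "S \<in> H" for S
  proof -
    have "p ^ card (T - (U \<union> S)) \<le> p ^ card (T - U) + of_bool (T = S)
      + (of_bool (T \<inter> S \<noteq> {}) * p ^ (k - 1)
        + of_bool (2 \<le> card (T \<inter> (U \<union> S))) * p + of_bool (?P S T))" if T: "T \<in> H" for T
    proof -
      have c: "card (T - (U \<union> S)) = k - card (T \<inter> (U \<union> S))"
        using card_edge[OF T] finite_edge[OF T] by (simp add: card_Diff_subset_Int)
      let ?a = "of_bool (T \<inter> S \<noteq> {}) * p ^ (k - 1)"
        and ?b = "of_bool (2 \<le> card (T \<inter> (U \<union> S))) * p" and ?c = "of_bool (?P S T) :: real"
      have nonneg: "0 \<le> ?a" "0 \<le> ?b" "0 \<le> ?c" "0 \<le> p ^ card (T - U)" "0 \<le> (of_bool (T = S) :: real)"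
        using p_pos by simp_all
      have le1: "p ^ card (T - (U \<union> S)) \<le> 1" using p_pos p_le_1 by (simp add: power_le_one)
      consider "T = S" | "T \<inter> S = {}" | "?P S T" | "T \<inter> S \<noteq> {}" "\<not> T \<subseteq> U \<union> S" by blast
      then show ?thesis
      proof cases
        case 1
        then have "(of_bool (T = S) :: real) = 1" by simp
        then show ?thesis using le1 nonneg by linarith
      next
        case 2
        then have "T - (U \<union> S) = T - U" by auto
        then show ?thesis using nonneg by simp
      next
        case 3
        then have "?c = 1" by simp
        then show ?thesis using le1 nonneg by linarith
      next
        case 4
        then have "T \<inter> (U \<union> S) \<noteq> {}" "T - (U \<union> S) \<noteq> {}" by auto
        then have 1: "1 \<le> card (T \<inter> (U \<union> S))" "1 \<le> card (T - (U \<union> S))"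
          using finite_edge[OF T] by (simp_all add: Suc_le_eq card_gt_0_iff)
        have "p ^ card (T - (U \<union> S)) \<le> ?a + ?b"
        proof (cases "2 \<le> card (T \<inter> (U \<union> S))")
          case True
          then have "?b = p" by simp
          then show ?thesis using power_le_p[OF 1(2)] nonneg by linarith
        next
          case False
          \<comment> \<open>The single common vertex lies in \<open>S\<close>, so this edge is
            already covered by the term with \<open>p ^ (k - 1)\<close>.\<close>
          then have "card (T \<inter> (U \<union> S)) = 1" using 1(1) by simp
          then have "p ^ card (T - (U \<union> S)) = ?a" using c 4(1) by simp
          then show ?thesis using nonneg by linarith
        qed
        then show ?thesis using nonneg by linarith
      qed
    qed
    then have "cond_mean (U \<union> S) \<le> (\<Sum>T\<in>H. p ^ card (T - U) + of_bool (T = S)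
      + (of_bool (T \<inter> S \<noteq> {}) * p ^ (k - 1)
        + of_bool (2 \<le> card (T \<inter> (U \<union> S))) * p + of_bool (?P S T)))"
      unfolding cond_mean_def by (rule sum_mono)
    also have "\<dots> = cond_mean U + (\<Sum>T\<in>H. of_bool (T = S)) + e S"
      by (simp only: sum.distrib cond_mean_def e_def)
    also have "(\<Sum>T\<in>H. of_bool (T = S)) = (1::real)"
      using S finite_H by (simp add: of_bool_def)
    finally show ?thesis .
  qed
  have e_le: "e S \<le> 1 / 4 + real (card {T \<in> H. ?P S T})" if S: "S \<in> H" for S
  proof -
    have "e S = real (card {T \<in> H. T \<inter> S \<noteq> {}}) * p ^ (k - 1)
      + real (card {T \<in> H. 2 \<le> card (T \<inter> (U \<union> S))}) * p + real (card {T \<in> H. ?P S T})"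
      unfolding e_def using finite_H by (simp add: sum.distrib Int_def flip: sum_distrib_right)
    also have "\<dots> \<le> real (k * \<Delta>) * p ^ (k - 1) + real (\<kappa> * (card U + k)\<^sup>2) * p + real (card {T \<in> H. ?P S T})"
    proof (intro add_mono mult_right_mono of_nat_mono order_refl)
      show "card {T \<in> H. T \<inter> S \<noteq> {}} \<le> k * \<Delta>"
        using card_meeting_le[OF edge_subset[OF S]] card_edge[OF S] by simp
      have "card (U \<union> S) \<le> card U + k" using card_Un_le[of U S] card_edge[OF S] by simp
      then have "(card (U \<union> S))\<^sup>2 \<le> (card U + k)\<^sup>2" by (intro power_mono) auto
      then have "(card (U \<union> S))\<^sup>2 * \<kappa> \<le> (card U + k)\<^sup>2 * \<kappa>" by (rule mult_right_mono) simp
      moreover have "card {T \<in> H. 2 \<le> card (T \<inter> (U \<union> S))} \<le> (card (U \<union> S))\<^sup>2 * \<kappa>"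
        using finU finite_edge[OF S] by (intro card_meeting_twice_le) simp
      ultimately show "card {T \<in> H. 2 \<le> card (T \<inter> (U \<union> S))} \<le> \<kappa> * (card U + k)\<^sup>2"
        unfolding mult.commute[of \<kappa>] by (rule order_trans[rotated])
    qed (use p_pos in simp_all)
    also have "\<dots> \<le> 1 / 4 + real (card {T \<in> H. ?P S T})"
      using p_small by (intro add_right_mono) simp
    finally show ?thesis .
  qed
  let ?bad = "{S \<in> H. 1 < e S}" and ?in = "{S \<in> H. S \<subseteq> U}"
  let ?good = "{S \<in> H. \<not> S \<subseteq> U \<and> cond_mean (U \<union> S) \<le> cond_mean U + 2}"
  have "real (card ?bad) = (\<Sum>S\<in>?bad. 1)" by simp
  also have "\<dots> \<le> (\<Sum>S\<in>?bad. e S)" by (intro sum_mono) auto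
  also have "\<dots> \<le> (\<Sum>S\<in>H. e S)" using finite_H e_nonneg by (intro sum_mono2) auto
  also have "\<dots> \<le> (\<Sum>S\<in>H. 1 / 4 + real (card {T \<in> H. ?P S T}))" using e_le by (rule sum_mono)
  also have "\<dots> = real (card H) / 4 + real (\<Sum>S\<in>H. card {T \<in> H. ?P S T})"
    by (simp add: sum.distrib)
  also have "\<dots> \<le> real (card H) / 4
      + real (\<kappa> * (card U)\<^sup>2 * (k * \<Delta>) + card U * \<Delta> * (k\<^sup>2 * \<kappa>))"
    using card_pairs_in_Un_le[OF assms(1,2)] by (intro add_left_mono of_nat_mono)
  finally have bad: "real (card ?bad) \<le> real (card H) / 4
      + real \<kappa> * (real (card U))\<^sup>2 * (real k * real \<Delta>) + real (card U) * real \<Delta> * ((real k)\<^sup>2 * real \<kappa>)"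
    by simp
  have "card ?in \<le> card {S \<in> H. 2 \<le> card (S \<inter> U)}"
    using card_edge k_ge_2 finite_H by (intro card_mono) (auto simp: Int_absorb2)
  also have "\<dots> \<le> (card U)\<^sup>2 * \<kappa>" by (rule card_meeting_twice_le[OF finU])
  finally have "real (card ?in) \<le> real ((card U)\<^sup>2 * \<kappa>)" by (rule of_nat_mono)
  then have inside: "real (card ?in) \<le> real \<kappa> * (real (card U))\<^sup>2" by (simp add: mult.commute)
  have "H \<subseteq> ?good \<union> ?bad \<union> ?in"
  proof
    fix S assume S: "S \<in> H"
    have "cond_mean (U \<union> S) \<le> cond_mean U + 2 \<or> 1 < e S" using step[OF S] by linarith
    then show "S \<in> ?good \<union> ?bad \<union> ?in" using S by blast
  qed
  then have "card H \<le> card (?good \<union> ?bad \<union> ?in)" using finite_H by (intro card_mono) auto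
  also have "\<dots> \<le> card (?good \<union> ?bad) + card ?in" by (rule card_Un_le)
  also have "\<dots> \<le> card ?good + card ?bad + card ?in" by (intro add_right_mono card_Un_le)
  finally have "real (card H) \<le> real (card ?good) + real (card ?bad) + real (card ?in)"
    by linarith
  then show ?thesis using bad inside H_large by (simp add: algebra_simps)
qed

end

section \<open>The upper tail\<close>

text \<open>The orders of magnitude of progressions: degrees linear in \<open>n\<close>, bounded
  codegrees, quadratically many edges. The density is written as a square because it is used as a
  lower bound \<open>\<sigma> * n * p^(k/2)\<close> for the root of the mean.\<close>

locale dense_binomial_hypergraph = binomial_hypergraph +
  fixes n :: nat and \<sigma> :: real
  assumes k_ge_3: "3 \<le> k" and card_V_le: "card V \<le> n" and \<Delta>_le: "\<Delta> \<le> k * n" and \<kappa>_le: "\<kappa> \<le> k\<^sup>2"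
    and n_pos: "0 < n" and \<sigma>_pos: "0 < \<sigma>" and \<sigma>_le_1: "\<sigma> \<le> 1"
    and card_H_ge: "\<sigma>\<^sup>2 * (real n)\<^sup>2 \<le> real (card H)"
begin

definition \<mu> :: real where "\<mu> = real (card H) * p ^ k"

definition L :: real where "L = ln (1 / p)"

definition \<Phi> :: real where "\<Phi> = min \<mu> (sqrt \<mu> * L)"

text \<open>With the fourth root as base, half-integral powers of \<open>p\<close> become natural
  powers, and a spare \<open>r\<close> or \<open>r\<^sup>2\<close> can absorb a factor
  \<open>L\<close>.\<close>

definition r :: real where "r = p powr (1 / 4)"

section \<open>Logarithms of p against spare powers of p\<close>

lemma r_pos: "0 < r" and r_le_1: "r \<le> 1" and r_power_4: "r ^ 4 = p"
proof -
  show "0 < r" using p_pos by (simp add: r_def)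
  show "r \<le> 1" using p_pos p_le_1 by (simp add: r_def powr_le1)
  have "r ^ 4 = r powr (real 4)" using \<open>0 < r\<close> by (subst powr_realpow) auto
  then show "r ^ 4 = p" using p_pos by (simp add: r_def powr_powr)
qed

lemma L_eq: "L = 4 * ln (1 / r)"
  using p_pos by (simp add: L_def r_def ln_div ln_powr)

lemma L_nonneg: "0 \<le> L"
  using p_pos p_le_1 by (simp add: L_def)

lemma L_mult_r_le: "L * r \<le> 4"
proof -
  have "ln (1 / r) \<le> 1 / r - 1" using r_pos by (intro ln_le_minus_one) simp
  then show ?thesis using r_pos L_eq by (simp add: field_simps)
qed

lemma L_mult_r2_le: "L * r\<^sup>2 \<le> 2"
proof -
  have "ln (1 / r\<^sup>2) \<le> 1 / r\<^sup>2 - 1" using r_pos by (intro ln_le_minus_one) simp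
  moreover have "ln (1 / r\<^sup>2) = 2 * ln (1 / r)"
    using r_pos by (simp add: ln_div ln_realpow)
  ultimately have "L / 2 \<le> 1 / r\<^sup>2 - 1" using L_eq by simp
  then have "L / 2 * r\<^sup>2 \<le> (1 / r\<^sup>2 - 1) * r\<^sup>2" by (rule mult_right_mono) simp
  also have "\<dots> = 1 - r\<^sup>2" using r_pos by (simp add: field_simps)
  finally show ?thesis using zero_le_power2[of r] by linarith
qed

lemma card_H_pos: "0 < real (card H)"
proof -
  have "0 < \<sigma>\<^sup>2 * (real n)\<^sup>2" using \<sigma>_pos n_pos by simp
  then show ?thesis using card_H_ge by linarith
qed

lemma \<mu>_pos: "0 < \<mu>"
  using card_H_pos p_pos by (simp add: \<mu>_def)

text \<open>The density gives \<open>sqrt \<mu> \<ge> \<sigma> * n * r ^ (2 * k)\<close>, and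
  \<open>4 * (k - 1) \<ge> 2 * k + 2\<close> holds exactly for \<open>k \<ge> 3\<close>; this leaves
  the spare factor \<open>r\<^sup>2\<close>.\<close>

lemma np_le: "real n * p ^ (k - 1) \<le> sqrt \<mu> * r\<^sup>2 / \<sigma>"
proof -
  have "(\<sigma> * real n * r ^ (2 * k))\<^sup>2 = \<sigma>\<^sup>2 * (real n)\<^sup>2 * p ^ k"
  proof -
    have "(r ^ (2 * k))\<^sup>2 = (r ^ 4) ^ k" by (simp add: mult.commute flip: power_mult)
    then show ?thesis by (simp only: power_mult_distrib r_power_4)
  qed
  also have "\<dots> \<le> \<mu>" unfolding \<mu>_def using card_H_ge p_pos by (intro mult_right_mono) auto
  finally have 1: "\<sigma> * real n * r ^ (2 * k) \<le> sqrt \<mu>" by (rule real_le_rsqrt)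
  have "p ^ (k - 1) = r ^ (4 * (k - 1))" by (simp only: power_mult r_power_4)
  also have "\<dots> \<le> r ^ (2 * k + 2)" using r_pos r_le_1 k_ge_3 by (intro power_decreasing) auto
  finally have "real n * p ^ (k - 1) \<le> real n * r ^ (2 * k + 2)" by (rule mult_left_mono) simp
  also have "\<dots> = (\<sigma> * real n * r ^ (2 * k)) * r\<^sup>2 / \<sigma>"
    using \<sigma>_pos by (simp add: power_add power2_eq_square)
  also have "\<dots> \<le> sqrt \<mu> * r\<^sup>2 / \<sigma>"
    using 1 \<sigma>_pos by (intro divide_right_mono mult_right_mono) auto
  finally show ?thesis .
qed

text \<open>The choice of \<open>D\<close> makes the base of the \<open>D\<close>-th power at most
  \<open>r = exp (- L / 4)\<close>. Half of the resulting exponent pays for the \<open>n\<close>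
  possible kernels, since \<open>D * L\<close> is at least
  \<open>12 * k * max L (sqrt \<mu>)\<close>.\<close>

lemma prob_star_le:
  assumes p1: "p < 1" and n: "ln (real n) \<le> real k * max L (sqrt \<mu>)"
    and D: "12 * real k / \<sigma> * max 1 (sqrt \<mu> / L) \<le> real D"
  shows "real (card V) * real (\<Delta> choose D) * p ^ (D * (k - 1)) \<le> exp (- (real D / 8) * L)"
proof -
  have L: "0 < L" using p1 p_pos by (simp add: L_def)
  have "0 < 12 * real k / \<sigma> * max 1 (sqrt \<mu> / L)"
    using k_ge_3 \<sigma>_pos by (intro mult_pos_pos divide_pos_pos) auto
  then have D_pos: "0 < D" using D by simp
  have base: "exp 1 * (real k * real n) / real D * p ^ (k - 1) \<le> r"
  proof -
    have "exp 1 * (real k * real n) / real D * p ^ (k - 1) = exp 1 * real k * (real n * p ^ (k - 1)) / real D"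
      by simp
    also have "\<dots> \<le> 3 * real k * (sqrt \<mu> * r\<^sup>2 / \<sigma>) / real D"
      using np_le exp_le p_pos by (intro divide_right_mono mult_mono) auto
    \<comment> \<open>Everything cancels to \<open>L * r\<^sup>2 / 4\<close>, and
      \<open>L * r \<le> 4\<close> leaves one factor \<open>r\<close>.\<close>
    also have "\<dots> \<le> 3 * real k * (sqrt \<mu> * r\<^sup>2 / \<sigma>) / (12 * real k / \<sigma> * (sqrt \<mu> / L))"
    proof (rule divide_left_mono)
      have "12 * real k / \<sigma> * (sqrt \<mu> / L) \<le> 12 * real k / \<sigma> * max 1 (sqrt \<mu> / L)"
        using \<sigma>_pos by (intro mult_left_mono) auto
      then show "12 * real k / \<sigma> * (sqrt \<mu> / L) \<le> real D" using D by linarith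
      show "0 \<le> 3 * real k * (sqrt \<mu> * r\<^sup>2 / \<sigma>)" using \<mu>_pos \<sigma>_pos by simp
      have "0 < 12 * real k / \<sigma> * (sqrt \<mu> / L)" using k_ge_3 \<sigma>_pos L \<mu>_pos by simp
      then show "0 < real D * (12 * real k / \<sigma> * (sqrt \<mu> / L))"
        using D_pos by (intro mult_pos_pos[of "real D"]) simp_all
    qed
    also have "\<dots> = (L * r) * r / 4"
      using k_ge_3 \<sigma>_pos L \<mu>_pos by (simp add: field_simps power2_eq_square)
    also have "\<dots> \<le> 4 * r / 4"
      using L_mult_r_le r_pos by (intro divide_right_mono mult_right_mono) auto
    finally show ?thesis by simp
  qed
  have "real (\<Delta> choose D) \<le> (exp 1 * real \<Delta> / real D) ^ D"
    by (rule binomial_le_exp_power[OF D_pos])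
  also have "\<dots> \<le> (exp 1 * (real k * real n) / real D) ^ D"
    using \<Delta>_le by (intro power_mono divide_right_mono mult_left_mono) (auto simp flip: of_nat_mult)
  finally have ch: "real (\<Delta> choose D) \<le> (exp 1 * (real k * real n) / real D) ^ D" .
  have "real (card V) * real (\<Delta> choose D) * p ^ (D * (k - 1))
      \<le> real n * (exp 1 * (real k * real n) / real D) ^ D * p ^ (D * (k - 1))"
    using ch card_V_le p_pos by (intro mult_right_mono mult_mono) auto
  also have "\<dots> = real n * (exp 1 * (real k * real n) / real D * p ^ (k - 1)) ^ D"
  proof -
    have "p ^ (D * (k - 1)) = (p ^ (k - 1)) ^ D" by (simp add: mult.commute flip: power_mult)
    then show ?thesis by (simp only: power_mult_distrib[of _ "p ^ (k - 1)"] mult.assoc)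
  qed
  also have "\<dots> \<le> real n * r ^ D"
    using base p_pos by (intro mult_left_mono power_mono) auto
  also have "\<dots> = exp (ln (real n) - real D * (L / 4))"
  proof -
    have "r ^ D = exp (real D * ln r)" using r_pos by (simp add: exp_of_nat_mult)
    moreover have "ln r = - L / 4" using L_eq r_pos by (simp add: ln_div)
    ultimately have "real n * r ^ D = exp (ln (real n)) * exp (real D * (- L / 4))"
      using n_pos by simp
    also have "\<dots> = exp (ln (real n) + real D * (- L / 4))" by (rule exp_add[symmetric])
    finally show ?thesis by simp
  qed
  also have "\<dots> \<le> exp (- (real D / 8) * L)"
  proof -
    define m where "m = max 1 (sqrt \<mu> / L)"
    have mL: "max L (sqrt \<mu>) = m * L"
    proof (cases "L \<le> sqrt \<mu>")
      case True
      then have "1 \<le> sqrt \<mu> / L" using L by (simp add: pos_le_divide_eq)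
      then show ?thesis using True L by (simp add: m_def max_absorb2)
    next
      case False
      then have "sqrt \<mu> / L \<le> 1" "sqrt \<mu> \<le> L" using L by (simp_all add: pos_divide_le_eq)
      then show ?thesis using L by (simp add: m_def max_absorb1)
    qed
    have m: "1 \<le> m" by (simp add: m_def)
    have "\<sigma> \<le> 12 / 8" using \<sigma>_le_1 by simp
    then have "1 \<le> 12 / \<sigma> / 8" using \<sigma>_pos by (simp add: pos_le_divide_eq)
    then have "1 * (real k * (m * L)) \<le> (12 / \<sigma> / 8) * (real k * (m * L))"
      using L m by (intro mult_right_mono) simp_all
    also have "\<dots> = (12 * real k / \<sigma> * m) * (L / 8)" by simp
    also have "\<dots> \<le> real D * (L / 8)"
      using D[folded m_def] L by (intro mult_right_mono) simp_all
    finally show ?thesis using n[unfolded mL] by simp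
  qed
  finally show ?thesis .
qed

text \<open>In units of \<open>\<epsilon> * \<mu>\<close>, edges meeting \<open>U\<close> once or
  twice add 1/8 each and edges inside \<open>U\<close> add 1/20 + 1/8, in total less than 1/2. The
  factor \<open>min \<epsilon> (sqrt \<epsilon>)\<close> is forced by the terms linear in
  \<open>card U\<close>, which need \<open>s \<le> \<epsilon>\<close>, and the quadratic one, which
  needs \<open>s\<^sup>2 \<le> \<epsilon>\<close>.\<close>

lemma cond_mean_le_of_no_stars:
  fixes \<epsilon> :: real and d R d' :: nat
  defines "c \<equiv> \<sigma> / (480 * real k ^ 5)" and "K \<equiv> sqrt (\<epsilon> * \<mu>) / (4 * (real k)\<^sup>2)"
    and "m \<equiv> max 1 (sqrt \<mu> / L)"
  assumes p1: "p < 1" and \<epsilon>: "0 < \<epsilon>"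
    and d: "0 < d" "real d \<le> 24 * real k / \<sigma> * m"
    and R: "0 < R" "real (R - 1) * real d \<le> K" and d': "2 \<le> R \<Longrightarrow> real d' \<le> 2 * K"
    and A: "A \<subseteq> V" "U \<subseteq> A"
    and no: "\<nexists>\<F>. disjoint_stars d R A \<F>" "2 \<le> R \<Longrightarrow> \<nexists>\<F>. disjoint_stars d' 1 A \<F>"
    and U: "real (card U) \<le> real k * (c * min \<epsilon> (sqrt \<epsilon>) * \<Phi>)"
  shows "cond_mean U \<le> (1 + \<epsilon> / 2) * \<mu>"
proof -
  define s where "s = min \<epsilon> (sqrt \<epsilon>)"
  have s: "0 < s" "s \<le> \<epsilon>" "s\<^sup>2 \<le> \<epsilon>"
  proof -
    show "0 < s" "s \<le> \<epsilon>" using \<epsilon> by (auto simp: s_def)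
    have "s\<^sup>2 \<le> (sqrt \<epsilon>)\<^sup>2" using \<epsilon> by (intro power_mono) (auto simp: s_def)
    then show "s\<^sup>2 \<le> \<epsilon>" using \<epsilon> by simp
  qed
  have L: "0 < L" using p1 p_pos by (simp add: L_def)
  have c: "0 < c" using \<sigma>_pos k_ge_3 by (simp add: c_def)
  have k3: "3 \<le> real k" using k_ge_3 by simp
  have m: "1 \<le> m" by (simp add: m_def)
  \<comment> \<open>The star size is of order \<open>m\<close> and \<open>card U\<close> of order
    \<open>\<mu> / m\<close>, so \<open>m\<close> cancels in their product.\<close>
  have \<Phi>_eq: "\<Phi> = \<mu> / m"
  proof -
    have "sqrt \<mu> * L \<le> sqrt \<mu> * sqrt \<mu> \<longleftrightarrow> 1 \<le> sqrt \<mu> / L"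
      using L \<mu>_pos by (subst mult_le_cancel_left_pos) auto
    then have "sqrt \<mu> * L \<le> \<mu> \<longleftrightarrow> 1 \<le> sqrt \<mu> / L"
      using \<mu>_pos by simp
    moreover have "\<mu> / (sqrt \<mu> / L) = (\<mu> / sqrt \<mu>) * L" by simp
    moreover have "\<mu> / sqrt \<mu> = sqrt \<mu>" using \<mu>_pos by (intro real_div_sqrt) simp
    ultimately show ?thesis by (auto simp: \<Phi>_def m_def min_def max_def)
  qed
  have U1: "real (card U) \<le> real k * c * s * (\<mu> / m)"
    using U unfolding s_def[symmetric] \<Phi>_eq by (simp add: mult_ac)
  have U2: "real (card U) \<le> real k * c * s * (sqrt \<mu> * L)"
  proof -
    have "real k * c * s * \<Phi> \<le> real k * c * s * (sqrt \<mu> * L)"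
      using c s(1) by (intro mult_left_mono) (auto simp: \<Phi>_def)
    then show ?thesis using U unfolding s_def[symmetric] by (simp add: mult_ac)
  qed
  have kpow: "(real k)\<^sup>2 * c \<le> \<sigma> / 480" "(real k)\<^sup>2 * c \<le> 1 / 480"
  proof -
    have "(real k)\<^sup>2 \<le> real k ^ 5" using k3 by (intro power_increasing) auto
    then have "(real k)\<^sup>2 / real k ^ 5 \<le> 1" using k3 by simp
    then have "(\<sigma> / 480) * ((real k)\<^sup>2 / real k ^ 5) \<le> (\<sigma> / 480) * 1"
      using \<sigma>_pos by (intro mult_left_mono) auto
    then show "(real k)\<^sup>2 * c \<le> \<sigma> / 480" by (simp add: c_def field_simps)
    then show "(real k)\<^sup>2 * c \<le> 1 / 480" using \<sigma>_le_1 by linarith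
  qed
  \<comment> \<open>The bound \<open>U2\<close> brings in a factor \<open>L\<close>, which the
    \<open>r\<^sup>2\<close> of \<open>np_le\<close> absorbs.\<close>
  have T1: "real (card U) * real \<Delta> * p ^ (k - 1) \<le> \<epsilon> * \<mu> / 8"
  proof -
    have "real (card U) * real \<Delta> * p ^ (k - 1) \<le> real (card U) * (real k * real n) * p ^ (k - 1)"
      using \<Delta>_le p_pos by (intro mult_right_mono mult_left_mono) (auto simp flip: of_nat_mult)
    also have "\<dots> = real (card U) * real k * (real n * p ^ (k - 1))" by simp
    also have "\<dots> \<le> real k * c * s * (sqrt \<mu> * L) * real k * (sqrt \<mu> * r\<^sup>2 / \<sigma>)"
      using U2 np_le p_pos c s(1) \<mu>_pos L by (intro mult_mono) auto
    also have "\<dots> = ((real k)\<^sup>2 * c) * s * \<mu> * (L * r\<^sup>2) / \<sigma>"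
    proof -
      have "\<mu> = sqrt \<mu> * sqrt \<mu>" using \<mu>_pos by simp
      then have "((real k)\<^sup>2 * c) * s * \<mu> * (L * r\<^sup>2) / \<sigma>
          = ((real k)\<^sup>2 * c) * s * (sqrt \<mu> * sqrt \<mu>) * (L * r\<^sup>2) / \<sigma>" by (simp only:)
      then show ?thesis by (simp only: power2_eq_square mult_ac times_divide_eq_left times_divide_eq_right)
    qed
    also have "\<dots> = ((real k)\<^sup>2 * c) * (s * (L * r\<^sup>2)) * (\<mu> / \<sigma>)" by simp
    also have "\<dots> \<le> (\<sigma> / 480) * (\<epsilon> * 2) * (\<mu> / \<sigma>)"
    proof (rule mult_right_mono)
      have "s * (L * r\<^sup>2) \<le> \<epsilon> * 2"
        using s L_mult_r2_le L \<epsilon> by (intro mult_mono) simp_all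
      from mult_mono[OF kpow(1) this]
      show "((real k)\<^sup>2 * c) * (s * (L * r\<^sup>2)) \<le> (\<sigma> / 480) * (\<epsilon> * 2)"
        using s(1) L \<sigma>_pos by simp
      show "0 \<le> \<mu> / \<sigma>" using \<mu>_pos \<sigma>_pos by simp
    qed
    also have "\<dots> \<le> \<epsilon> * \<mu> / 8" using \<sigma>_pos \<epsilon> \<mu>_pos by simp
    finally show ?thesis .
  qed
  have T2: "real \<kappa> * (real (card U))\<^sup>2 * p \<le> \<epsilon> * \<mu> / 8"
  proof -
    have "real \<kappa> \<le> (real k)\<^sup>2" using \<kappa>_le by (simp flip: of_nat_power)
    moreover have "(real (card U))\<^sup>2 \<le> (real k * c * s * (sqrt \<mu> * L))\<^sup>2"
      using U2 by (intro power_mono) simp_all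
    ultimately have "real \<kappa> * (real (card U))\<^sup>2
        \<le> (real k)\<^sup>2 * (real k * c * s * (sqrt \<mu> * L))\<^sup>2"
      by (rule mult_mono) simp_all
    then have "real \<kappa> * (real (card U))\<^sup>2 * p
        \<le> (real k)\<^sup>2 * (real k * c * s * (sqrt \<mu> * L))\<^sup>2 * r ^ 4"
      unfolding r_power_4 using p_pos by (intro mult_right_mono) simp_all
    also have "\<dots> = ((real k)\<^sup>2 * c)\<^sup>2 * s\<^sup>2 * (sqrt \<mu>)\<^sup>2 * (L * r\<^sup>2)\<^sup>2"
      by (simp add: power_mult_distrib flip: power_mult)
    also have "(sqrt \<mu>)\<^sup>2 = \<mu>" using \<mu>_pos by simp
    also have "((real k)\<^sup>2 * c)\<^sup>2 * s\<^sup>2 * \<mu> * (L * r\<^sup>2)\<^sup>2 \<le> (1 / 480)\<^sup>2 * \<epsilon> * \<mu> * 2\<^sup>2"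
    proof -
      have "((real k)\<^sup>2 * c)\<^sup>2 \<le> (1 / 480)\<^sup>2" using kpow(2) c by (intro power_mono) simp_all
      from mult_mono[OF this s(3)] have "((real k)\<^sup>2 * c)\<^sup>2 * s\<^sup>2 \<le> (1 / 480)\<^sup>2 * \<epsilon>"
        by simp
      then have "((real k)\<^sup>2 * c)\<^sup>2 * s\<^sup>2 * \<mu> \<le> (1 / 480)\<^sup>2 * \<epsilon> * \<mu>"
        using \<mu>_pos by (intro mult_right_mono) simp_all
      moreover have "(L * r\<^sup>2)\<^sup>2 \<le> 2\<^sup>2" using L_mult_r2_le L by (intro power_mono) simp_all
      ultimately show ?thesis by (rule mult_mono) (use \<epsilon> \<mu>_pos in simp_all)
    qed
    also have "\<dots> \<le> \<epsilon> * \<mu> / 8" using \<epsilon> \<mu>_pos by (simp add: power2_eq_square)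
    finally show ?thesis .
  qed
  have T3: "real (num_edges U) \<le> \<epsilon> * \<mu> / 20 + \<epsilon> * \<mu> / 8"
  proof -
    have "num_edges U \<le> k * \<kappa> * d * card U + (R - 1) * d * d' * k\<^sup>2 * \<kappa>"
      using A d R no by (intro num_edges_le_of_no_stars) auto
    also have "\<dots> \<le> k * k\<^sup>2 * d * card U + (R - 1) * d * d' * k\<^sup>2 * k\<^sup>2"
      using \<kappa>_le by (intro add_mono mult_mono) auto
    finally have "real (num_edges U)
        \<le> real (k * k\<^sup>2 * d * card U + (R - 1) * d * d' * k\<^sup>2 * k\<^sup>2)" by (rule of_nat_mono)
    also have "\<dots> = real k ^ 3 * real d * real (card U) + real (R - 1) * real d * real d' * real k ^ 4"
      by (simp add: power2_eq_square power3_eq_cube power4_eq_xxxx)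
    also have "\<dots> \<le> \<epsilon> * \<mu> / 20 + \<epsilon> * \<mu> / 8"
    proof (rule add_mono)
      have "real k ^ 3 * real d * real (card U)
          \<le> real k ^ 3 * (24 * real k / \<sigma> * m) * (real k * c * s * (\<mu> / m))"
      proof -
        have "real d * real (card U) \<le> (24 * real k / \<sigma> * m) * (real k * c * s * (\<mu> / m))"
          using \<sigma>_pos m by (intro mult_mono[OF d(2) U1]) simp_all
        then have "real k ^ 3 * (real d * real (card U))
            \<le> real k ^ 3 * ((24 * real k / \<sigma> * m) * (real k * c * s * (\<mu> / m)))"
          by (rule mult_left_mono) simp
        then show ?thesis by (simp only: mult.assoc)
      qed
      \<comment> \<open>This fixes \<open>c\<close>: \<open>k ^ 5\<close> and
        \<open>\<sigma>\<close> cancel, and 480 = 24 * 20.\<close>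
      also have "\<dots> = s * \<mu> / 20"
        using m \<sigma>_pos k3 unfolding c_def by (simp add: field_simps power_def numeral_eq_Suc)
      also have "\<dots> \<le> \<epsilon> * \<mu> / 20" using s \<mu>_pos by simp
      finally show "real k ^ 3 * real d * real (card U) \<le> \<epsilon> * \<mu> / 20" .
      show "real (R - 1) * real d * real d' * real k ^ 4 \<le> \<epsilon> * \<mu> / 8"
      proof (cases "2 \<le> R")
        case True
        \<comment> \<open>The denominator \<open>4 * k\<^sup>2\<close> of \<open>K\<close> is chosen
          so that \<open>2 * K\<^sup>2 * k ^ 4\<close> is
          \<open>\<epsilon> * \<mu> / 8\<close>.\<close>
        have "real (R - 1) * real d * real d' * real k ^ 4 \<le> K * (2 * K) * real k ^ 4"
          using mult_mono[OF R(2) d'[OF True]] \<epsilon> \<mu>_pos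
          by (intro mult_right_mono) (simp_all add: K_def)
        also have "\<dots> = 2 * (K * (real k)\<^sup>2)\<^sup>2" by (simp add: power_mult_distrib power2_eq_square power4_eq_xxxx)
        also have "K * (real k)\<^sup>2 = sqrt (\<epsilon> * \<mu>) / 4" using k3 by (simp add: K_def)
        also have "2 * (sqrt (\<epsilon> * \<mu>) / 4)\<^sup>2 = \<epsilon> * \<mu> / 8"
          using \<epsilon> \<mu>_pos by (simp add: power_divide)
        finally show ?thesis .
      next
        case False
        then have "R - 1 = 0" by simp
        then show ?thesis using \<epsilon> \<mu>_pos by simp
      qed
    qed
    finally show ?thesis .
  qed
  have "U \<subseteq> V" using A by auto
  from cond_mean_le[OF this] have "cond_mean U \<le> \<mu> + \<epsilon> * \<mu> / 8 + \<epsilon> * \<mu> / 8 + (\<epsilon> * \<mu> / 20 + \<epsilon> * \<mu> / 8)"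
    using T1 T2 T3 unfolding \<mu>_def[symmetric] by linarith
  also have "\<dots> \<le> (1 + \<epsilon> / 2) * \<mu>" using \<epsilon> \<mu>_pos by (simp add: field_simps)
  finally show ?thesis .
qed

end

section \<open>Combining moments, stars and Markov's inequality\<close>

lemma nat_floor_ge_half: "1 \<le> x \<Longrightarrow> x / 2 \<le> real (nat \<lfloor>x\<rfloor>)" for x :: real
proof -
  assume x: "1 \<le> x"
  then have "1 \<le> \<lfloor>x\<rfloor>" by simp
  then show "x / 2 \<le> real (nat \<lfloor>x\<rfloor>)" using x by linarith
qed

lemma exp_half_min_le:
  fixes \<epsilon> :: real
  assumes "0 < \<epsilon>"
  shows "1 / (1 + \<epsilon>) \<le> exp (- (min \<epsilon> 1 / 2))"
proof -
  define x where "x = min \<epsilon> 1 / 2"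
  have x: "0 \<le> x" "x \<le> 1 / 2" "2 * x \<le> \<epsilon>" using assms by (auto simp: x_def)
  have "exp x \<le> 1 + x + x\<^sup>2" using x by (intro exp_bound) auto
  also have "x\<^sup>2 \<le> 1 * x" unfolding power2_eq_square using x by (intro mult_right_mono) auto
  finally have "exp x \<le> 1 + \<epsilon>" using x by linarith
  then have "inverse (1 + \<epsilon>) \<le> inverse (exp x)" by (intro le_imp_inverse_le) auto
  then show ?thesis unfolding x_def[symmetric] by (simp add: exp_minus divide_inverse)
qed

lemma ratio_le_exp:
  fixes \<epsilon> :: real
  assumes "0 < \<epsilon>"
  shows "(1 + \<epsilon> / 2) / (1 + \<epsilon>) \<le> exp (- (min \<epsilon> 1 / 4))"
proof -
  have "min \<epsilon> 1 / 4 \<le> (\<epsilon> / 2) / (1 + \<epsilon>)"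
  proof (cases "\<epsilon> \<le> 1")
    case True
    then have "\<epsilon> * (1 + \<epsilon>) \<le> \<epsilon> * 2" using assms by (intro mult_left_mono) auto
    then show ?thesis using True assms by (simp add: pos_le_divide_eq min_absorb1)
  next
    case False
    then show ?thesis by (simp add: pos_le_divide_eq min_absorb2)
  qed
  moreover have "(1 + \<epsilon> / 2) / (1 + \<epsilon>) = 1 + - ((\<epsilon> / 2) / (1 + \<epsilon>))"
    using assms by (simp add: field_simps)
  moreover have "1 + - ((\<epsilon> / 2) / (1 + \<epsilon>)) \<le> exp (- ((\<epsilon> / 2) / (1 + \<epsilon>)))"
    by (rule exp_ge_add_one_self)
  ultimately show ?thesis by (smt (verit) exp_le_cancel_iff)
qed

context dense_binomial_hypergraph
begin

lemma \<Phi>_nonneg: "0 \<le> \<Phi>"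
  using \<mu>_pos L_nonneg by (simp add: \<Phi>_def)

lemma prob_ge_le_Markov:
  assumes "0 < \<epsilon>"
  shows "measure_pmf.prob M {A. (1 + \<epsilon>) * \<mu> \<le> real (num_edges A)} \<le> 1 / (1 + \<epsilon>)"
proof -
  have "(1 + \<epsilon>) * \<mu> * measure_pmf.prob M {A. (1 + \<epsilon>) * \<mu> \<le> real (num_edges A)} =
      E (\<lambda>A. (1 + \<epsilon>) * \<mu> * of_bool ((1 + \<epsilon>) * \<mu> \<le> real (num_edges A)))"
    by (simp add: E_of_bool)
  also have "\<dots> \<le> E (\<lambda>A. real (num_edges A))"
    by (intro E_mono) auto
  also have "\<dots> = \<mu>" by (simp add: E_num_edges \<mu>_def)
  finally have "((1 + \<epsilon>) * measure_pmf.prob M {A. (1 + \<epsilon>) * \<mu> \<le> real (num_edges A)}) * \<mu> \<le> 1 * \<mu>"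
    by (simp add: mult_ac)
  then have "(1 + \<epsilon>) * measure_pmf.prob M {A. (1 + \<epsilon>) * \<mu> \<le> real (num_edges A)} \<le> 1"
    using \<mu>_pos by (rule mult_right_le_imp_le)
  then show ?thesis using assms by (simp only: pos_le_divide_eq[OF add_pos_pos[OF zero_less_one assms]] mult.commute)
qed

text \<open>One exponential for each of three events: \<open>R\<close> disjoint stars of size
  \<open>d\<close>, one star of size \<open>d'\<close>, and a large count in the absence of both. As
  \<open>R * d\<close> and \<open>d'\<close> are both at least \<open>K\<close>, the star events
  cost \<open>exp (- (K / 8 * L))\<close> each.\<close>

lemma upper_tail_three_exp:
  fixes \<epsilon> :: real
  defines "c \<equiv> \<sigma> / (480 * real k ^ 5)" and "s \<equiv> min \<epsilon> (sqrt \<epsilon>)"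
  assumes p1: "p < 1" and n: "ln (real n) \<le> real k * max L (sqrt \<mu>)"
    and \<epsilon>: "0 < \<epsilon>" and cs\<Phi>: "1 \<le> c * s * \<Phi>"
  shows "measure_pmf.prob M {A. (1 + \<epsilon>) * \<mu> \<le> real (num_edges A)}
    \<le> 3 * exp (- (c / 8 * (min \<epsilon> 1 * s * \<Phi>)))"
proof -
  define l where "l = nat \<lfloor>c * s * \<Phi>\<rfloor>"
  define m where "m = max 1 (sqrt \<mu> / L)"
  define d where "d = nat \<lfloor>24 * real k / \<sigma> * m\<rfloor>"
  define K where "K = sqrt (\<epsilon> * \<mu>) / (4 * (real k)\<^sup>2)"
  \<comment> \<open>\<open>R = 1\<close> means that a single star of size \<open>d\<close> already
    reaches \<open>K\<close>; the event concerning \<open>d'\<close> is then void.\<close>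
  define R where "R = nat \<lceil>K / real d\<rceil>"
  define d' where "d' = nat \<lceil>K\<rceil>"
  define x where "x = c / 8 * (min \<epsilon> 1 * s * \<Phi>)"
  have L: "0 < L" using p1 p_pos by (simp add: L_def)
  have k3: "3 \<le> real k" using k_ge_3 by simp
  have c: "0 < c" using \<sigma>_pos k_ge_3 by (simp add: c_def)
  have s: "0 < s" using \<epsilon> by (simp add: s_def)
  have m: "1 \<le> m" by (simp add: m_def)
  have K: "0 < K" using \<epsilon> \<mu>_pos k3 by (simp add: K_def)
  have d1: "1 \<le> 24 * real k / \<sigma> * m"
  proof -
    have "\<sigma> \<le> 24 * real k" using k3 \<sigma>_le_1 by linarith
    then have "1 \<le> 24 * real k / \<sigma>" using \<sigma>_pos by (simp add: pos_le_divide_eq)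
    then have "1 * 1 \<le> 24 * real k / \<sigma> * m" using m by (intro mult_mono) auto
    then show ?thesis by simp
  qed
  have d_ub: "real d \<le> 24 * real k / \<sigma> * m" using d1 unfolding d_def by linarith
  have d_lb: "12 * real k / \<sigma> * m \<le> real d" using nat_floor_ge_half[OF d1] by (simp add: d_def mult_ac)
  have d_pos: "0 < d" using d1 unfolding d_def by linarith
  have R_pos: "0 < R" using K d_pos by (simp add: R_def)
  have R_lb: "K \<le> real R * real d"
  proof -
    have "K / real d \<le> real R" unfolding R_def by linarith
    then show ?thesis using d_pos by (simp add: pos_divide_le_eq)
  qed
  have R_ub: "real (R - 1) * real d \<le> K"
  proof -
    have "real (R - 1) \<le> K / real d" using R_pos unfolding R_def by linarith
    then show ?thesis using d_pos by (simp add: pos_le_divide_eq)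
  qed
  have big: "real d < K" if "2 \<le> R"
  proof -
    have "1 < K / real d" using that unfolding R_def by linarith
    then show ?thesis using d_pos by (simp add: pos_less_divide_eq)
  qed
  \<comment> \<open>Here \<open>K > d \<ge> 1\<close>, so rounding up at most doubles
    \<open>K\<close>.\<close>
  have d'_ub: "real d' \<le> 2 * K" if "2 \<le> R" using big[OF that] d_pos unfolding d'_def by linarith
  have d'_lb: "K \<le> real d'" unfolding d'_def by linarith
  \<comment> \<open>The star events allow no more than \<open>sqrt \<epsilon>\<close> in the
    exponent; this is why \<open>s\<close> is capped by \<open>sqrt \<epsilon>\<close> for large
    \<open>\<epsilon>\<close>.\<close>
  have x_le: "x \<le> K / 8 * L"
  proof -
    have "(real k)\<^sup>2 \<le> real k ^ 5" using k3 by (intro power_increasing) auto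
    then have "4 * (real k)\<^sup>2 * \<sigma> \<le> (480 * real k ^ 5) * 1"
      using \<sigma>_pos \<sigma>_le_1 k3 by (intro mult_mono) auto
    then have "c \<le> 1 / (4 * (real k)\<^sup>2)" using k3 by (simp add: c_def field_simps)
    moreover have "min \<epsilon> 1 * s * \<Phi> \<le> sqrt \<epsilon> * (sqrt \<mu> * L)"
    proof (rule mult_mono)
      have "min \<epsilon> 1 * s \<le> 1 * sqrt \<epsilon>" using \<epsilon> s by (intro mult_mono) (auto simp: s_def)
      then show "min \<epsilon> 1 * s \<le> sqrt \<epsilon>" by simp
    qed (use \<epsilon> \<Phi>_nonneg in \<open>auto simp: \<Phi>_def\<close>)
    ultimately have "c * (min \<epsilon> 1 * s * \<Phi>) \<le> 1 / (4 * (real k)\<^sup>2) * (sqrt \<epsilon> * (sqrt \<mu> * L))"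
      by (rule mult_mono) (use \<epsilon> s \<Phi>_nonneg in auto)
    then show ?thesis by (simp add: x_def K_def real_sqrt_mult mult_ac)
  qed
  let ?B1 = "{A. \<exists>\<F>. disjoint_stars d R A \<F>}"
  let ?B2 = "{A. 2 \<le> R \<and> (\<exists>\<F>. disjoint_stars d' 1 A \<F>)}"
  have B1: "measure_pmf.prob M ?B1 \<le> exp (- x)"
  proof -
    have "measure_pmf.prob M ?B1 \<le> (real (card V) * real (\<Delta> choose d) * p ^ (d * (k - 1))) ^ R"
      by (rule prob_disjoint_stars_le)
    also have "\<dots> \<le> exp (- (real d / 8) * L) ^ R"
      using prob_star_le[OF p1 n d_lb[unfolded m_def]] p_pos by (intro power_mono) auto
    also have "\<dots> = exp (- (real R * real d / 8 * L))"
      by (simp add: exp_of_nat_mult[symmetric])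
    also have "\<dots> \<le> exp (- (K / 8 * L))" using R_lb L by simp
    also have "\<dots> \<le> exp (- x)" using x_le by simp
    finally show ?thesis .
  qed
  have B2: "measure_pmf.prob M ?B2 \<le> exp (- x)"
  proof (cases "2 \<le> R")
    case True
    have d'd: "12 * real k / \<sigma> * max 1 (sqrt \<mu> / L) \<le> real d'"
      using d_lb big[OF True] d'_lb unfolding m_def by linarith
    have "measure_pmf.prob M ?B2 = measure_pmf.prob M {A. \<exists>\<F>. disjoint_stars d' 1 A \<F>}"
      using True by simp
    also have "\<dots> \<le> (real (card V) * real (\<Delta> choose d') * p ^ (d' * (k - 1))) ^ 1"
      by (rule prob_disjoint_stars_le)
    also have "\<dots> \<le> exp (- (real d' / 8) * L)"
      using prob_star_le[OF p1 n d'd] by simp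
    also have "\<dots> \<le> exp (- (K / 8 * L))" using d'_lb L by simp
    also have "\<dots> \<le> exp (- x)" using x_le by simp
    finally show ?thesis .
  qed simp
  have A: "measure_pmf.prob M {A. A \<in> - (?B1 \<union> ?B2) \<and> (1 + \<epsilon>) * \<mu> \<le> real (num_edges A)} \<le> exp (- x)"
  proof -
    have "measure_pmf.prob M {A. A \<in> - (?B1 \<union> ?B2) \<and> (1 + \<epsilon>) * \<mu> \<le> real (num_edges A)}
        \<le> ((1 + \<epsilon> / 2) * \<mu> / ((1 + \<epsilon>) * \<mu>)) ^ l"
    proof (rule prob_num_edges_ge_le)
      fix A U assume A: "A \<in> - (?B1 \<union> ?B2)" "U \<subseteq> A" "A \<subseteq> V" "card U \<le> k * l"
      have "real (card U) \<le> real k * real l" using A(4) by (simp flip: of_nat_mult)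
      also have "\<dots> \<le> real k * (c * s * \<Phi>)"
        using cs\<Phi> unfolding l_def by (intro mult_left_mono) linarith+
      finally have U: "real (card U) \<le> real k * (\<sigma> / (480 * real k ^ 5) * min \<epsilon> (sqrt \<epsilon>) * \<Phi>)"
        by (simp add: c_def s_def)
      show "cond_mean U \<le> (1 + \<epsilon> / 2) * \<mu>"
        using A(1) d'_ub
        by (intro cond_mean_le_of_no_stars[OF p1 \<epsilon> d_pos d_ub[unfolded m_def] R_pos
              R_ub[unfolded K_def] _ A(3,2) _ _ U, of d'])
          (auto simp: K_def)
    qed (use \<epsilon> \<mu>_pos in auto)
    also have "(1 + \<epsilon> / 2) * \<mu> / ((1 + \<epsilon>) * \<mu>) = (1 + \<epsilon> / 2) / (1 + \<epsilon>)"
      using \<mu>_pos by simp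
    also have "((1 + \<epsilon> / 2) / (1 + \<epsilon>)) ^ l \<le> exp (- (min \<epsilon> 1 / 4)) ^ l"
      using \<epsilon> by (intro power_mono ratio_le_exp) auto
    also have "\<dots> = exp (- (real l * (min \<epsilon> 1 / 4)))"
      by (simp add: exp_of_nat_mult[symmetric])
    also have "\<dots> \<le> exp (- x)"
    proof -
      \<comment> \<open>The 8 in \<open>x\<close> is a factor 2 from the floor in \<open>l\<close>
        and a factor 4 from \<open>ratio_le_exp\<close>.\<close>
      have "(c * s * \<Phi> / 2) * (min \<epsilon> 1 / 4) \<le> real l * (min \<epsilon> 1 / 4)"
        using nat_floor_ge_half[OF cs\<Phi>] \<epsilon> unfolding l_def by (intro mult_right_mono) auto
      moreover have "(c * s * \<Phi> / 2) * (min \<epsilon> 1 / 4) = x" by (simp add: x_def)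
      ultimately have "x \<le> real l * (min \<epsilon> 1 / 4)" by (simp only:)
      then show ?thesis by (simp only: exp_le_cancel_iff neg_le_iff_le)
    qed
    finally show ?thesis .
  qed
  have "measure_pmf.prob M {A. (1 + \<epsilon>) * \<mu> \<le> real (num_edges A)}
    \<le> measure_pmf.prob M ({A. A \<in> - (?B1 \<union> ?B2) \<and> (1 + \<epsilon>) * \<mu> \<le> real (num_edges A)} \<union> (?B1 \<union> ?B2))"
    by (rule measure_pmf.finite_measure_mono) auto
  also have "\<dots> \<le> measure_pmf.prob M {A. A \<in> - (?B1 \<union> ?B2) \<and> (1 + \<epsilon>) * \<mu> \<le> real (num_edges A)}
      + (measure_pmf.prob M ?B1 + measure_pmf.prob M ?B2)"
    by (rule order_trans[OF measure_Un_le add_left_mono[OF measure_Un_le]]) auto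
  also have "\<dots> \<le> 3 * exp (- x)" using A B1 B2 by linarith
  finally show ?thesis by (simp add: x_def)
qed

text \<open>Once \<open>24 \<le> c * (g * \<Phi>)\<close>, half of the exponent
  \<open>y \<ge> 3\<close> absorbs the factor 3. Below that, or if the moment order would be less
  than 1, Markov's inequality is enough at the price of another \<open>min \<epsilon> 1\<close>,
  turning \<open>g = \<epsilon>\<^sup>2\<close> into \<open>\<epsilon> ^ 3\<close> for small
  \<open>\<epsilon>\<close>. The constant is 480 * 48, with 48 = 2 * 24.\<close>

lemma upper_tail:
  fixes \<epsilon> :: real
  assumes p1: "p < 1" and n: "ln (real n) \<le> real k * max L (sqrt \<mu>)" and \<epsilon>: "0 < \<epsilon>"
  shows "measure_pmf.prob M {A. (1 + \<epsilon>) * \<mu> \<le> real (num_edges A)}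
    \<le> exp (- (\<sigma> / (23040 * real k ^ 5) * min (\<epsilon> ^ 3) (sqrt \<epsilon>) * \<Phi>))"
proof -
  define c where "c = \<sigma> / (480 * real k ^ 5)"
  define s where "s = min \<epsilon> (sqrt \<epsilon>)"
  define f where "f = min (\<epsilon> ^ 3) (sqrt \<epsilon>)"
  define g where "g = min \<epsilon> 1 * s"
  have c: "0 < c" using \<sigma>_pos k_ge_3 by (simp add: c_def)
  have s: "0 < s" using \<epsilon> by (simp add: s_def)
  have f_le: "f \<le> min \<epsilon> 1 * g"
  proof (cases "\<epsilon> \<le> 1")
    case True
    have "\<epsilon> * \<epsilon> \<le> \<epsilon>" using True \<epsilon> by (simp add: mult_left_le)
    then have "\<epsilon> \<le> sqrt \<epsilon>" by (intro real_le_rsqrt) (simp add: power2_eq_square)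
    then show ?thesis using True by (simp add: f_def g_def s_def power3_eq_cube min_absorb1)
  next
    case False
    then have "sqrt \<epsilon> \<le> sqrt (\<epsilon>\<^sup>2)" by (intro real_sqrt_le_mono) (simp add: power2_eq_square)
    then have "sqrt \<epsilon> \<le> \<epsilon>" using \<epsilon> by simp
    then show ?thesis using False by (simp add: f_def g_def s_def min_absorb2)
  qed
  have g0: "0 \<le> g" using \<epsilon> s by (simp add: g_def)
  have Markov: ?thesis if "c / 48 * f * \<Phi> \<le> min \<epsilon> 1 / 2"
  proof -
    have "measure_pmf.prob M {A. (1 + \<epsilon>) * \<mu> \<le> real (num_edges A)} \<le> exp (- (min \<epsilon> 1 / 2))"
      using prob_ge_le_Markov[OF \<epsilon>] exp_half_min_le[OF \<epsilon>] by linarith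
    also have "\<dots> \<le> exp (- (c / 48 * f * \<Phi>))" using that by simp
    finally show ?thesis by (simp add: c_def f_def)
  qed
  have f\<Phi>: "f * \<Phi> \<le> min \<epsilon> 1 * (g * \<Phi>)"
    using f_le \<Phi>_nonneg by (simp only: mult.assoc[symmetric] mult_right_mono)
  consider "c * s * \<Phi> < 1" | "1 \<le> c * s * \<Phi>" "c * (g * \<Phi>) < 24" | "1 \<le> c * s * \<Phi>" "24 \<le> c * (g * \<Phi>)"
    by linarith
  then show ?thesis
  proof cases
    case 1
    have "g \<le> 1 * s" unfolding g_def using s by (intro mult_right_mono) auto
    then have "c * (g * \<Phi>) \<le> c * (s * \<Phi>)" using c \<Phi>_nonneg by (intro mult_left_mono mult_right_mono) auto
    then have "c * (g * \<Phi>) \<le> 24" using 1 by (simp add: mult.assoc)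
    then have "min \<epsilon> 1 * (c * (g * \<Phi>)) \<le> min \<epsilon> 1 * 24" using \<epsilon> by (intro mult_left_mono) auto
    moreover have "c * (f * \<Phi>) \<le> c * (min \<epsilon> 1 * (g * \<Phi>))" using f\<Phi> c by (intro mult_left_mono) auto
    moreover have "c * (min \<epsilon> 1 * (g * \<Phi>)) = min \<epsilon> 1 * (c * (g * \<Phi>))" by (rule mult.left_commute)
    ultimately have "c * (f * \<Phi>) \<le> min \<epsilon> 1 * 24" by linarith
    moreover have "c / 48 * f * \<Phi> = c * (f * \<Phi>) / 48" by simp
    ultimately show ?thesis by (intro Markov) linarith
  next
    case 2
    then have "min \<epsilon> 1 * (c * (g * \<Phi>)) \<le> min \<epsilon> 1 * 24" using \<epsilon> by (intro mult_left_mono) auto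
    moreover have "c * (f * \<Phi>) \<le> c * (min \<epsilon> 1 * (g * \<Phi>))" using f\<Phi> c by (intro mult_left_mono) auto
    moreover have "c * (min \<epsilon> 1 * (g * \<Phi>)) = min \<epsilon> 1 * (c * (g * \<Phi>))" by (rule mult.left_commute)
    ultimately have "c * (f * \<Phi>) \<le> min \<epsilon> 1 * 24" by linarith
    moreover have "c / 48 * f * \<Phi> = c * (f * \<Phi>) / 48" by simp
    ultimately show ?thesis by (intro Markov) linarith
  next
    case 3
    define y where "y = c / 8 * (g * \<Phi>)"
    have y: "3 \<le> y" using 3 by (simp add: y_def)
    have "measure_pmf.prob M {A. (1 + \<epsilon>) * \<mu> \<le> real (num_edges A)} \<le> 3 * exp (- y)"
      using upper_tail_three_exp[OF p1 n \<epsilon>] 3(1) unfolding c_def s_def y_def g_def by blast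
    also have "3 \<le> exp (y / 2)"
    proof -
      have "(1 + 1 + 1\<^sup>2 / 2 :: real) \<le> exp 1" by (intro exp_lower_Taylor_quadratic) simp
      then have "(5 / 2 :: real) \<le> exp 1" by simp
      moreover have "1 + 1 / 2 \<le> exp (1 / 2 :: real)" by (rule exp_ge_add_one_self)
      ultimately have "(5 / 2) * (3 / 2) \<le> exp 1 * exp (1 / 2 :: real)" by (intro mult_mono) auto
      also have "\<dots> = exp (3 / 2)" by (simp add: exp_add[symmetric])
      also have "\<dots> \<le> exp (y / 2)" using y by simp
      finally show ?thesis by simp
    qed
    then have "3 * exp (- y) \<le> exp (y / 2) * exp (- y)" by (intro mult_right_mono) auto
    also have "\<dots> = exp (- (y / 2))" by (simp add: exp_add[symmetric])
    also have "\<dots> \<le> exp (- (c / 48 * f * \<Phi>))"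
    proof -
      have "min \<epsilon> 1 * (g * \<Phi>) \<le> 1 * (g * \<Phi>)" using g0 \<Phi>_nonneg by (intro mult_right_mono) auto
      then have "f * \<Phi> \<le> g * \<Phi>" using f\<Phi> by simp
      then have "c * (f * \<Phi>) \<le> c * (g * \<Phi>)" using c by (intro mult_left_mono) auto
      moreover have "0 \<le> c * (g * \<Phi>)" using c g0 \<Phi>_nonneg by simp
      ultimately show ?thesis by (simp add: y_def mult.assoc)
    qed
    finally show ?thesis by (simp add: c_def f_def)
  qed
qed

end

section \<open>The lower tail\<close>

context dense_binomial_hypergraph
begin

text \<open>If \<open>ln n\<close> exceeds \<open>k * L\<close>, then
  \<open>p ^ k \<ge> 1 / n\<close>, so \<open>\<mu> \<ge> \<sigma>\<^sup>2 * n\<close> and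
  \<open>sqrt \<mu>\<close> dominates the logarithm.\<close>

lemma ln_n_le:
  assumes "ln (real n) \<le> real k * \<sigma> * sqrt (real n)"
  shows "ln (real n) \<le> real k * max L (sqrt \<mu>)"
proof (cases "ln (real n) \<le> real k * L")
  case True
  also have "real k * L \<le> real k * max L (sqrt \<mu>)" by (intro mult_left_mono) auto
  finally show ?thesis .
next
  case False
  have "- ln (real n) \<le> real k * ln p"
    using False p_pos by (simp add: L_def ln_div)
  then have "exp (- ln (real n)) \<le> exp (real k * ln p)" by simp
  also have "\<dots> = p ^ k" using p_pos by (simp add: exp_of_nat_mult)
  finally have "1 / real n \<le> p ^ k" using n_pos by (simp add: exp_minus inverse_eq_divide)
  then have "\<sigma>\<^sup>2 * (real n)\<^sup>2 * (1 / real n) \<le> \<sigma>\<^sup>2 * (real n)\<^sup>2 * p ^ k"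
    by (intro mult_left_mono) auto
  also have "\<dots> \<le> \<mu>" unfolding \<mu>_def using card_H_ge p_pos by (intro mult_right_mono) auto
  finally have "\<sigma>\<^sup>2 * (real n)\<^sup>2 * (1 / real n) \<le> \<mu>" .
  moreover have "\<sigma>\<^sup>2 * (real n)\<^sup>2 * (1 / real n) = \<sigma>\<^sup>2 * real n"
    using n_pos by (simp add: power2_eq_square)
  moreover have "(\<sigma> * sqrt (real n))\<^sup>2 = \<sigma>\<^sup>2 * real n"
    by (simp add: power_mult_distrib)
  ultimately have "(\<sigma> * sqrt (real n))\<^sup>2 \<le> \<mu>" by simp
  then have "\<sigma> * sqrt (real n) \<le> sqrt \<mu>" by (rule real_le_rsqrt)
  also have "\<dots> \<le> max L (sqrt \<mu>)" by simp
  finally have "real k * (\<sigma> * sqrt (real n)) \<le> real k * max L (sqrt \<mu>)"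
    by (rule mult_left_mono) simp
  then show ?thesis using assms by (simp add: mult.assoc)
qed

lemma prob_ge_planted:
  assumes "W \<subseteq> V" and "x \<le> real (num_edges W)" and "real (card W) \<le> w"
  shows "exp (- (w * L)) \<le> measure_pmf.prob M {A. x \<le> real (num_edges A)}"
proof -
  have "exp (- (w * L)) \<le> exp (- (real (card W) * L))"
    using assms(3) L_nonneg by (simp add: mult_right_mono)
  also have "\<dots> = p ^ card W"
  proof -
    have "exp (- (real (card W) * L)) = exp (real (card W) * ln p)"
      using p_pos by (simp add: L_def ln_div)
    then show ?thesis using p_pos by (simp add: exp_of_nat_mult)
  qed
  also have "\<dots> = measure_pmf.prob M {A. W \<subseteq> A}" using prob_superset[OF assms(1)] by simp
  also have "\<dots> \<le> measure_pmf.prob M {A. x \<le> real (num_edges A)}"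
  proof (rule prob_mono)
    fix A assume "W \<subseteq> A"
    then have "num_edges W \<le> num_edges A"
      unfolding num_edges_def using finite_H by (intro card_mono) auto
    then show "x \<le> real (num_edges A)" using assms(2) by linarith
  qed
  finally show ?thesis .
qed

text \<open>Checks \<open>card_good_edges_ge\<close> for all \<open>U\<close> reached within
  \<open>t\<close> steps. The error terms there add up to three times
  \<open>k ^ 6 * t\<^sup>2 * n\<close>, and a quarter of \<open>card H\<close> is available; hence
  the 12 in \<open>n_large\<close>.\<close>

lemma prob_ge_Poisson:
  fixes t :: nat
  assumes t: "0 < t" "\<mu> \<le> real t"
    and p_small: "(real k)\<^sup>2 * (real n * p ^ (k - 1)) + (real k)\<^sup>2 * (real k * real t + real k)\<^sup>2 * p \<le> 1 / 4"
    and n_large: "12 * real k ^ 6 * (real t)\<^sup>2 \<le> \<sigma>\<^sup>2 * real n"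
  shows "(\<mu> / (12 * real t)) ^ t / 2 \<le> measure_pmf.prob M {A. t \<le> num_edges A}"
  unfolding \<mu>_def
proof (rule prob_num_edges_ge_ge)
  show "0 < t" "real (card H) * p ^ k \<le> real t" using t by (simp_all add: \<mu>_def)
  fix U assume U: "U \<subseteq> V" "card U \<le> k * t"
  have U': "real (card U) \<le> real k * real t" using U(2) by (simp flip: of_nat_mult)
  have \<kappa>: "real \<kappa> \<le> (real k)\<^sup>2" using \<kappa>_le by (simp flip: of_nat_power)
  have \<Delta>: "real \<Delta> \<le> real k * real n" using \<Delta>_le by (simp flip: of_nat_mult)
  have k3: "3 \<le> real k" using k_ge_3 by simp
  have n1: "1 \<le> real n" and t1: "1 \<le> real t" using n_pos t by simp_all
  show "real (card H) / 2
    \<le> real (card {S \<in> H. \<not> S \<subseteq> U \<and> cond_mean (U \<union> S) \<le> cond_mean U + 2})"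
  proof (rule card_good_edges_ge[OF k_ge_3 U(1)])
    have "real k * real \<Delta> * p ^ (k - 1) \<le> real k * (real k * real n) * p ^ (k - 1)"
      using \<Delta> p_pos by (intro mult_right_mono mult_left_mono) auto
    moreover have "real \<kappa> * (real (card U) + real k)\<^sup>2 \<le> (real k)\<^sup>2 * (real k * real t + real k)\<^sup>2"
      using \<kappa> U' by (intro mult_mono power_mono) auto
    then have "real \<kappa> * (real (card U) + real k)\<^sup>2 * p \<le> (real k)\<^sup>2 * (real k * real t + real k)\<^sup>2 * p"
      using p_pos by (intro mult_right_mono) auto
    moreover have "real k * (real k * real n) * p ^ (k - 1) = (real k)\<^sup>2 * (real n * p ^ (k - 1))"
      by (simp add: power2_eq_square)
    ultimately show "real k * real \<Delta> * p ^ (k - 1) + real \<kappa> * (real (card U) + real k)\<^sup>2 * p \<le> 1 / 4"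
      using p_small by linarith
  next
    let ?X = "real k ^ 6 * ((real t)\<^sup>2 * real n)"
    have A: "real \<kappa> * (real (card U))\<^sup>2 * (1 + real k * real \<Delta>) \<le> 2 * ?X"
    proof -
      have "real k * real \<Delta> \<le> real k * (real k * real n)" using \<Delta> by (intro mult_left_mono) auto
      moreover have "1 * 1 \<le> real k * (real k * real n)"
        using k3 n1 mult_mono[of 1 "real k" 1 "real n"] by (intro mult_mono) auto
      ultimately have 1: "1 + real k * real \<Delta> \<le> 2 * (real k * (real k * real n))" by linarith
      have 2: "(real (card U))\<^sup>2 \<le> (real k * real t)\<^sup>2" using U' by (intro power_mono) auto
      have "real \<kappa> * (real (card U))\<^sup>2 * (1 + real k * real \<Delta>)
        \<le> (real k)\<^sup>2 * (real k * real t)\<^sup>2 * (2 * (real k * (real k * real n)))"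
        by (rule mult_mono[OF mult_mono[OF \<kappa> 2] 1]) auto
      also have "\<dots> = 2 * ?X" by (simp add: power_def numeral_eq_Suc mult_ac)
      finally show ?thesis .
    qed
    have B: "real (card U) * real \<Delta> * ((real k)\<^sup>2 * real \<kappa>) \<le> ?X"
    proof -
      have "(real k)\<^sup>2 * real \<kappa> \<le> (real k)\<^sup>2 * (real k)\<^sup>2" using \<kappa> by (rule mult_left_mono) auto
      then have "real (card U) * real \<Delta> * ((real k)\<^sup>2 * real \<kappa>)
        \<le> (real k * real t) * (real k * real n) * ((real k)\<^sup>2 * (real k)\<^sup>2)"
        by (intro mult_mono[OF mult_mono[OF U' \<Delta>]]) auto
      also have "\<dots> = real k ^ 6 * (real t * real n)" by (simp add: power_def numeral_eq_Suc mult_ac)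
      also have "\<dots> \<le> ?X"
      proof -
        have "real t * 1 \<le> (real t)\<^sup>2" unfolding power2_eq_square using t1 by (intro mult_left_mono) auto
        then show ?thesis by (intro mult_left_mono mult_right_mono) auto
      qed
      finally show ?thesis .
    qed
    have "12 * ?X = (12 * real k ^ 6 * (real t)\<^sup>2) * real n" by simp
    also have "\<dots> \<le> (\<sigma>\<^sup>2 * real n) * real n" using n_large by (intro mult_right_mono) auto
    also have "\<dots> \<le> real (card H)" using card_H_ge by (simp add: power2_eq_square mult.assoc)
    finally show "real \<kappa> * (real (card U))\<^sup>2 * (1 + real k * real \<Delta>)
        + real (card U) * real \<Delta> * ((real k)\<^sup>2 * real \<kappa>) \<le> real (card H) / 4"
      using A B by linarith
  qed
qed

text \<open>Planting a dense set of about \<open>sqrt x\<close> vertices is only too costly when \<open>p\<close> is polynomially small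
  and \<open>x\<close> is polylogarithmic; then the count behaves like a Poisson variable.\<close>

lemma lower_tail:
  fixes \<epsilon> :: real
  defines "z \<equiv> ln (real n)" and "x \<equiv> (1 + \<epsilon>) * \<mu>" and "En \<equiv> max 1 (\<epsilon>\<^sup>2)"
  assumes \<epsilon>: "0 < \<epsilon>" and n2: "2 \<le> n" and x1: "1 \<le> x"
    and card_H_le: "card H \<le> n\<^sup>2"
    and plant: "W \<subseteq> V" "x \<le> real (num_edges W)" "real (card W) \<le> 7 * real k * sqrt x"
    and np_small: "256 * z ^ 4 * (8 * (real k)\<^sup>2) ^ 3 \<le> \<sigma> ^ 4 * real n"
    and p_small: "(8 * (real k)\<^sup>2 * (32 * real k * z\<^sup>2 + real k)\<^sup>2) ^ k * (16 * z\<^sup>2) \<le> \<sigma>\<^sup>2 * (real n)\<^sup>2"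
    and n_large: "12 * real k ^ 6 * (32 * z\<^sup>2)\<^sup>2 \<le> \<sigma>\<^sup>2 * real n"
  shows "exp (- (200 * real k * En * \<Phi>)) \<le> measure_pmf.prob M {A. x \<le> real (num_edges A)}"
proof -
  have k3: "3 \<le> real k" using k_ge_3 by simp
  have En1: "1 \<le> En" and En2: "\<epsilon>\<^sup>2 \<le> En" by (auto simp: En_def)
  have sq: "(1 + \<epsilon>)\<^sup>2 \<le> 4 * En"
  proof -
    have "0 \<le> (1 - \<epsilon>)\<^sup>2" by simp
    then show ?thesis using En1 En2 by (simp add: power2_eq_square algebra_simps)
  qed
  have lin: "1 + \<epsilon> \<le> 2 * En"
  proof -
    have "0 \<le> (1 - \<epsilon>)\<^sup>2" by simp
    then have "2 * \<epsilon> \<le> 1 + \<epsilon>\<^sup>2" by (simp add: power2_eq_square algebra_simps)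
    then show ?thesis using En1 En2 by linarith
  qed
  have x_le: "x \<le> 2 * (En * \<mu>)"
    unfolding x_def using mult_right_mono[OF lin, of \<mu>] \<mu>_pos by (simp add: mult.assoc)
  have En\<Phi>: "0 \<le> En * \<Phi>" using En1 \<Phi>_nonneg by simp
  have planted: ?thesis if "7 * real k * sqrt x * L \<le> 200 * real k * En * \<Phi>"
  proof -
    have "exp (- (200 * real k * En * \<Phi>)) \<le> exp (- (7 * real k * sqrt x * L))" using that by simp
    also have "\<dots> \<le> measure_pmf.prob M {A. x \<le> real (num_edges A)}"
      by (rule prob_ge_planted[OF plant])
    finally show ?thesis .
  qed
  consider "\<Phi> = sqrt \<mu> * L" | "\<Phi> = \<mu>" "sqrt x * L \<le> En * \<mu>" | "\<Phi> = \<mu>" "En * \<mu> < sqrt x * L"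
  proof -
    have "\<Phi> = \<mu> \<or> \<Phi> = sqrt \<mu> * L" by (auto simp: \<Phi>_def min_def)
    then show ?thesis using that by (meson not_le)
  qed
  then show ?thesis
  proof cases
    case 1
    have "sqrt x = sqrt (1 + \<epsilon>) * sqrt \<mu>" by (simp add: x_def real_sqrt_mult)
    moreover have "sqrt (1 + \<epsilon>) \<le> 2 * En"
    proof (rule real_le_lsqrt[THEN order_trans])
      show "1 + \<epsilon> \<le> (1 + \<epsilon>)\<^sup>2" using \<epsilon> by (simp add: power2_eq_square algebra_simps)
    qed (use \<epsilon> lin in auto)
    ultimately have "sqrt x \<le> 2 * En * sqrt \<mu>" using \<mu>_pos by (simp add: mult_right_mono)
    then have "sqrt x * L \<le> 2 * En * sqrt \<mu> * L" using L_nonneg by (intro mult_right_mono) auto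
    then have "sqrt x * L \<le> 2 * (En * \<Phi>)" using 1 by (simp add: mult_ac)
    then have "7 * real k * (sqrt x * L) \<le> 7 * real k * (2 * (En * \<Phi>))" by (intro mult_left_mono) auto
    also have "\<dots> \<le> 200 * real k * (En * \<Phi>)" using En\<Phi> k3 by (simp add: mult_right_mono)
    finally show ?thesis by (intro planted) (simp add: mult.assoc)
  next
    case 2
    then have "7 * real k * (sqrt x * L) \<le> 7 * real k * (En * \<Phi>)" by (intro mult_left_mono) auto
    also have "\<dots> \<le> 200 * real k * (En * \<Phi>)" using En\<Phi> k3 by (simp add: mult_right_mono)
    finally show ?thesis by (intro planted) (simp add: mult.assoc)
  next
    case 3
    define t where "t = nat \<lceil>x\<rceil>"
    have t: "x \<le> real t" "real t \<le> 2 * x" "0 < t" using x1 unfolding t_def by linarith+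
    have sx: "1 \<le> sqrt x" "0 < sqrt x" "sqrt x * sqrt x = x" using x1 by auto
    have \<mu>x: "\<mu> \<le> x" unfolding x_def using \<epsilon> \<mu>_pos by simp
    \<comment> \<open>Expensive planting together with \<open>1 \<le> x\<close> forces
      \<open>\<mu> * L > 1 / 4\<close>, which bounds \<open>p\<close> from below in the next
      step.\<close>
    have L_pos: "1 / (4 * \<mu>) < L"
    proof -
      have "x * x \<le> 4 * (En * \<mu>) * \<mu>"
        unfolding x_def using mult_right_mono[OF sq, of "\<mu> * \<mu>"] by (simp add: power2_eq_square mult_ac)
      also have "\<dots> < 4 * (sqrt x * L) * \<mu>" using 3(2) \<mu>_pos by simp
      finally have "sqrt x * (sqrt x * x) < sqrt x * (4 * L * \<mu>)" using sx(3) by (simp add: mult_ac)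
      then have "sqrt x * x < 4 * L * \<mu>" by (simp only: mult_less_cancel_left_pos[OF sx(2)])
      moreover have "1 * 1 \<le> sqrt x * x" using sx x1 by (intro mult_mono) auto
      ultimately show ?thesis using \<mu>_pos by (simp add: pos_divide_less_eq mult_ac)
    qed
    then have L0: "0 < L" using \<mu>_pos by (smt (verit) divide_nonneg_nonneg)
    \<comment> \<open>Inserting \<open>\<mu> \<le> n\<^sup>2 * p ^ k\<close> and
      \<open>L * p \<le> 1\<close> yields \<open>p > 1 / (2 * n)\<close>, so \<open>L\<close> is at
      most of order \<open>ln n\<close>.\<close>
    have Lz: "L \<le> 2 * z"
    proof -
      have "1 < 4 * \<mu> * L" using L_pos \<mu>_pos by (simp add: pos_divide_less_eq mult_ac)
      also have "\<dots> \<le> 4 * ((real n)\<^sup>2 * p ^ k) * L"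
        using card_H_le p_pos L0 unfolding \<mu>_def
        by (intro mult_right_mono mult_left_mono) (auto simp flip: of_nat_power)
      also have "\<dots> = 4 * (real n)\<^sup>2 * p ^ (k - 1) * (L * p)"
        using k_ge_3 by (simp add: power_eq_if mult_ac)
      also have "\<dots> \<le> 4 * (real n)\<^sup>2 * p\<^sup>2 * 1"
      proof (intro mult_mono)
        show "p ^ (k - 1) \<le> p\<^sup>2" using p_pos p_le_1 k_ge_3 by (intro power_decreasing) auto
        have "ln (1 / p) \<le> 1 / p - 1" using p_pos by (intro ln_le_minus_one) simp
        then have "L * p \<le> (1 / p - 1) * p" unfolding L_def using p_pos by (intro mult_right_mono) auto
        also have "\<dots> \<le> 1" using p_pos by (simp add: field_simps)
        finally show "L * p \<le> 1" .
      qed (use L0 p_pos in auto)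
      finally have "1\<^sup>2 < (2 * real n * p)\<^sup>2" by (simp add: power_mult_distrib)
      then have "1 < 2 * real n * p" by (rule power2_less_imp_less) (use p_pos in simp)
      then have "1 / p < 2 * real n" using p_pos by (simp add: pos_divide_less_eq)
      also have "\<dots> \<le> real n * real n" using n2 by (intro mult_right_mono) auto
      finally have "L \<le> ln (real n * real n)" unfolding L_def using p_pos n_pos by simp
      then show ?thesis using n_pos by (simp add: z_def ln_mult)
    qed
    have xz: "x \<le> 16 * z\<^sup>2"
    proof -
      have "sqrt x * sqrt x < sqrt x * (2 * L)" using 3(2) x_le sx(3) by linarith
      then have "sqrt x < 2 * L" by (simp only: mult_less_cancel_left_pos[OF sx(2)])
      then have "sqrt x \<le> 4 * z" using Lz by linarith
      then have "(sqrt x)\<^sup>2 \<le> (4 * z)\<^sup>2" using sx by (intro power_mono) auto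
      then show ?thesis using x1 by (simp add: power_mult_distrib)
    qed
    have tz: "real t \<le> 32 * z\<^sup>2" using t xz by linarith
    have pk: "\<sigma>\<^sup>2 * (real n)\<^sup>2 * p ^ k \<le> 16 * z\<^sup>2"
    proof -
      have "\<sigma>\<^sup>2 * (real n)\<^sup>2 * p ^ k \<le> \<mu>" unfolding \<mu>_def using card_H_ge p_pos by (intro mult_right_mono) auto
      then show ?thesis using \<mu>x xz by linarith
    qed
    \<comment> \<open>Cubing avoids fractional exponents: \<open>3 * (k - 1) \<ge> 2 * k\<close> for
      \<open>k \<ge> 3\<close>, so the cube of \<open>p ^ (k - 1)\<close> is controlled by the
      square of \<open>p ^ k\<close>, known from \<open>pk\<close>. The factor 8 gives this term
      half of the 1/4 in \<open>prob_ge_Poisson\<close>.\<close>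
    have small1: "8 * (real k)\<^sup>2 * (real n * p ^ (k - 1)) \<le> 1"
    proof -
      have "(p ^ (k - 1)) ^ 3 = p ^ ((k - 1) * 3)" by (simp only: power_mult)
      also have "\<dots> \<le> p ^ (k * 2)" using p_pos p_le_1 k_ge_3 by (intro power_decreasing) auto
      also have "\<dots> = (p ^ k)\<^sup>2" by (simp only: power_mult)
      finally have p3: "(p ^ (k - 1)) ^ 3 \<le> (p ^ k)\<^sup>2" .
      have eq1: "a * b * (b * c) ^ 3 = a * b ^ 4 * c ^ 3" for a b c :: real
        by (simp add: power_mult_distrib numeral_eq_Suc)
      have eq2: "a ^ 4 * b ^ 4 * c\<^sup>2 = (a\<^sup>2 * b\<^sup>2 * c)\<^sup>2" for a b c :: real
        by (simp add: power_mult_distrib flip: power_mult)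
      have "\<sigma> ^ 4 * real n * (real n * p ^ (k - 1)) ^ 3 = \<sigma> ^ 4 * real n ^ 4 * (p ^ (k - 1)) ^ 3"
        by (rule eq1)
      also have "\<dots> \<le> \<sigma> ^ 4 * real n ^ 4 * (p ^ k)\<^sup>2" using \<sigma>_pos by (intro mult_left_mono[OF p3]) simp
      also have "\<dots> = (\<sigma>\<^sup>2 * (real n)\<^sup>2 * p ^ k)\<^sup>2" by (rule eq2)
      also have "\<dots> \<le> (16 * z\<^sup>2)\<^sup>2" using pk p_pos by (intro power_mono) simp_all
      also have "\<dots> = 256 * z ^ 4" by (simp add: power_mult_distrib flip: power_mult)
      finally have "\<sigma> ^ 4 * real n * (real n * p ^ (k - 1)) ^ 3 * (8 * (real k)\<^sup>2) ^ 3
          \<le> 256 * z ^ 4 * (8 * (real k)\<^sup>2) ^ 3" by (rule mult_right_mono) simp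
      also note np_small
      finally have "\<sigma> ^ 4 * real n * ((8 * (real k)\<^sup>2) * (real n * p ^ (k - 1))) ^ 3 \<le> \<sigma> ^ 4 * real n * 1 ^ 3"
        by (simp only: power_mult_distrib mult_ac power_one mult_1_right)
      then have le: "((8 * (real k)\<^sup>2) * (real n * p ^ (k - 1))) ^ 3 \<le> 1 ^ 3"
        by (rule mult_left_le_imp_le) (use \<sigma>_pos n_pos in auto)
      have three: "3 = Suc 2" by simp
      show ?thesis using le unfolding three by (rule power_le_imp_le_base) simp
    qed
    have small2: "8 * (real k)\<^sup>2 * (real k * real t + real k)\<^sup>2 * p \<le> 1"
    proof -
      let ?a = "8 * (real k)\<^sup>2 * (32 * real k * z\<^sup>2 + real k)\<^sup>2"
      have "real k * real t \<le> real k * (32 * z\<^sup>2)" using tz by (intro mult_left_mono) auto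
      then have "(real k * real t + real k)\<^sup>2 \<le> (32 * real k * z\<^sup>2 + real k)\<^sup>2"
        by (intro power_mono) auto
      then have le: "8 * (real k)\<^sup>2 * (real k * real t + real k)\<^sup>2 * p \<le> ?a * p"
        using p_pos by (intro mult_right_mono mult_left_mono) auto
      have "?a ^ k * (\<sigma>\<^sup>2 * (real n)\<^sup>2 * p ^ k) \<le> ?a ^ k * (16 * z\<^sup>2)"
        using pk by (intro mult_left_mono) auto
      also note p_small
      finally have "(?a * p) ^ k * (\<sigma>\<^sup>2 * (real n)\<^sup>2) \<le> 1 * (\<sigma>\<^sup>2 * (real n)\<^sup>2)"
        by (simp add: power_mult_distrib mult_ac)
      then have "(?a * p) ^ k \<le> 1"
        by (rule mult_right_le_imp_le) (use \<sigma>_pos n_pos in auto)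
      then have "(?a * p) ^ Suc (k - 1) \<le> 1 ^ Suc (k - 1)" using k_ge_3 by simp
      then have "?a * p \<le> 1" by (rule power_le_imp_le_base) auto
      then show ?thesis using le by linarith
    qed
    have large: "12 * real k ^ 6 * (real t)\<^sup>2 \<le> \<sigma>\<^sup>2 * real n"
    proof -
      have "(real t)\<^sup>2 \<le> (32 * z\<^sup>2)\<^sup>2" using tz by (intro power_mono) auto
      then have "12 * real k ^ 6 * (real t)\<^sup>2 \<le> 12 * real k ^ 6 * (32 * z\<^sup>2)\<^sup>2"
        by (intro mult_left_mono) auto
      then show ?thesis using n_large by linarith
    qed
    have "(\<mu> / (12 * real t)) ^ t / 2 \<le> measure_pmf.prob M {A. t \<le> num_edges A}"
      using t \<mu>x small1 small2 large by (intro prob_ge_Poisson) auto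
    also have "\<dots> \<le> measure_pmf.prob M {A. x \<le> real (num_edges A)}"
      using t(1) by (intro prob_mono) linarith
    finally have P: "(\<mu> / (12 * real t)) ^ t / 2 \<le> measure_pmf.prob M {A. x \<le> real (num_edges A)}" .
    have "exp (- (200 * real k * En * \<Phi>)) \<le> exp (- (194 * (En * \<mu>)))"
    proof -
      have "194 * (En * \<mu>) \<le> 200 * real k * (En * \<mu>)" using k3 En1 \<mu>_pos by (intro mult_right_mono) auto
      then show ?thesis using 3(1) by (simp add: mult.assoc)
    qed
    \<comment> \<open>The crude \<open>ln q \<le> q - 1\<close> costs a factor
      \<open>1 + \<epsilon>\<close>, which the square in \<open>En\<close> permits. Here 194 = 2 *
      24 * 4 + 2, the last 2 paying for \<open>ln 2\<close> because
      \<open>1 \<le> x \<le> 2 * (En * \<mu>)\<close>.\<close>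
    also have "\<dots> \<le> (\<mu> / (12 * real t)) ^ t / 2"
    proof -
      define q where "q = 12 * real t / \<mu>"
      have q: "0 < q" using t \<mu>_pos by (simp add: q_def)
      have "q \<le> 24 * (1 + \<epsilon>)"
      proof -
        have "24 * (1 + \<epsilon>) * \<mu> = 12 * (2 * x)" by (simp add: x_def)
        then have "12 * real t \<le> 24 * (1 + \<epsilon>) * \<mu>" using t(2) by linarith
        then show ?thesis by (simp only: q_def pos_divide_le_eq[OF \<mu>_pos])
      qed
      moreover have "ln q \<le> q - 1" using q by (rule ln_le_minus_one)
      ultimately have lnq: "ln q \<le> 24 * (1 + \<epsilon>)" by linarith
      have "real t * ln q \<le> real t * (24 * (1 + \<epsilon>))" using lnq by (intro mult_left_mono) auto
      also have "\<dots> \<le> 2 * x * (24 * (1 + \<epsilon>))" using t(2) \<epsilon> by (intro mult_right_mono) auto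
      also have "\<dots> = 48 * ((1 + \<epsilon>)\<^sup>2 * \<mu>)" by (simp add: x_def power2_eq_square)
      also have "\<dots> \<le> 48 * (4 * En * \<mu>)" using sq \<mu>_pos by (intro mult_left_mono mult_right_mono) auto
      finally have "real t * ln q \<le> 192 * (En * \<mu>)" by simp
      moreover have "ln 2 \<le> 2 * (En * \<mu>)" using ln_le_minus_one[of 2] x_le x1 by simp
      ultimately have "- (194 * (En * \<mu>)) \<le> - (real t * ln q) - ln 2" by simp
      then have "exp (- (194 * (En * \<mu>))) \<le> exp (- (real t * ln q) - ln 2)" by simp
      also have "\<dots> = exp (real t * - ln q) / 2" by (simp add: exp_diff)
      also have "exp (real t * - ln q) = (exp (- ln q)) ^ t" by (rule exp_of_nat_mult)
      also have "exp (- ln q) = \<mu> / (12 * real t)" using q by (simp add: exp_minus q_def)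
      finally show ?thesis .
    qed
    also note P
    finally show ?thesis .
  qed
qed

end

section \<open>Counting arithmetic progressions\<close>

lemma arith_progE:
  assumes "arith_prog k S" and "2 \<le> k"
  obtains a d where "0 < d" and "S = (\<lambda>i. a + i * d) ` {..<k}"
proof -
  obtain a d where S: "card S = k" "S = (\<lambda>i. a + i * d) ` {..<k}"
    using assms unfolding arith_prog_def by blast
  have "0 < d"
  proof (rule ccontr)
    assume "\<not> 0 < d"
    then have "S \<subseteq> {a}" using S by auto
    then have "card S \<le> 1" using card_mono[of "{a}" S] by simp
    then show False using S assms by simp
  qed
  then show ?thesis using S that by blast
qed

lemma arith_progI: "0 < d \<Longrightarrow> arith_prog k ((\<lambda>i. a + i * d) ` {..<k})"
  unfolding arith_prog_def by (auto simp: card_image inj_on_def)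

definition APs :: "nat \<Rightarrow> nat \<Rightarrow> nat set set" where
  "APs k n = {S. S \<subseteq> {1..n} \<and> arith_prog k S}"

lemma APs_memE:
  assumes "S \<in> APs k n" and "2 \<le> k"
  obtains a d where "0 < d" "d \<le> n" "1 \<le> a" "a \<le> n" and "S = (\<lambda>i. a + i * d) ` {..<k}"
proof -
  obtain a d where S: "0 < d" "S = (\<lambda>i. a + i * d) ` {..<k}"
    using assms unfolding APs_def by (blast elim: arith_progE)
  have "a + 0 * d \<in> S" "a + 1 * d \<in> S" using S assms(2) by (auto intro!: image_eqI)
  then have "1 \<le> a" "a + d \<le> n" using assms by (auto simp: APs_def)
  then show ?thesis using S that by simp
qed

text \<open>A progression through \<open>v\<close> is determined by the index of \<open>v\<close>
  and the common difference.\<close>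

lemma card_APs_degree_le:
  assumes "2 \<le> k"
  shows "card {S \<in> APs k n. v \<in> S} \<le> k * n"
proof -
  have "{S \<in> APs k n. v \<in> S} \<subseteq> (\<lambda>(j, d). (\<lambda>i. (v - j * d) + i * d) ` {..<k}) ` ({..<k} \<times> {1..n})"
  proof
    fix S assume "S \<in> {S \<in> APs k n. v \<in> S}"
    then have S: "S \<in> APs k n" "v \<in> S" by auto
    obtain a d where d: "0 < d" "d \<le> n" "S = (\<lambda>i. a + i * d) ` {..<k}"
      using APs_memE[OF S(1) assms] by metis
    then obtain j where "j < k" "v = a + j * d" using S(2) by blast
    then show "S \<in> (\<lambda>(j, d). (\<lambda>i. (v - j * d) + i * d) ` {..<k}) ` ({..<k} \<times> {1..n})"
      using d by (intro image_eqI[of _ _ "(j, d)"]) auto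
  qed
  then have "card {S \<in> APs k n. v \<in> S} \<le> card ({..<k} \<times> {1..n})"
    by (intro surj_card_le) auto
  then show ?thesis by (simp add: card_cartesian_product)
qed

text \<open>The indices of \<open>x\<close> and \<open>y\<close> determine the difference and the
  first term. Subtraction of naturals truncates, so \<open>diff\<close> treats the two orders
  separately; its value for equal indices is never reached.\<close>

lemma card_APs_codegree_le:
  assumes "2 \<le> k" and "x \<noteq> y"
  shows "card {S \<in> APs k n. x \<in> S \<and> y \<in> S} \<le> k\<^sup>2"
proof -
  define diff where "diff = (\<lambda>i j. if i < j then (y - x) div (j - i) else (x - y) div (i - j))"
  let ?f = "\<lambda>(i, j). (\<lambda>l. (x - i * diff i j) + l * diff i j) ` {..<k}"
  have "{S \<in> APs k n. x \<in> S \<and> y \<in> S} \<subseteq> ?f ` ({..<k} \<times> {..<k})"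
  proof
    fix S assume "S \<in> {S \<in> APs k n. x \<in> S \<and> y \<in> S}"
    then have S: "S \<in> APs k n" "x \<in> S" "y \<in> S" by auto
    obtain a d where d: "0 < d" "S = (\<lambda>i. a + i * d) ` {..<k}"
      using APs_memE[OF S(1) assms(1)] by metis
    then obtain i j where ij: "i < k" "x = a + i * d" "j < k" "y = a + j * d"
      using S(2,3) by blast
    have "i \<noteq> j" using ij assms(2) by auto
    have "diff i j = d"
    proof (cases "i < j")
      case True
      then have "y - x = d * (j - i)" using ij by (simp add: diff_mult_distrib2 mult.commute)
      then show ?thesis using True by (simp add: diff_def)
    next
      case False
      then have "x - y = d * (i - j)" using ij by (simp add: diff_mult_distrib2 mult.commute)
      then show ?thesis using False \<open>i \<noteq> j\<close> by (simp add: diff_def)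
    qed
    then show "S \<in> ?f ` ({..<k} \<times> {..<k})"
      using d ij by (intro image_eqI[of _ _ "(i, j)"]) auto
  qed
  then have "card {S \<in> APs k n. x \<in> S \<and> y \<in> S} \<le> card ({..<k} \<times> {..<k})"
    by (intro surj_card_le) auto
  then show ?thesis by (simp add: card_cartesian_product power2_eq_square)
qed

lemma card_APs_le:
  assumes "2 \<le> k"
  shows "card (APs k n) \<le> n\<^sup>2"
proof -
  have "APs k n \<subseteq> (\<lambda>(a, d). (\<lambda>i. a + i * d) ` {..<k}) ` ({1..n} \<times> {1..n})"
  proof
    fix S assume "S \<in> APs k n"
    then obtain a d where "0 < d" "d \<le> n" "1 \<le> a" "a \<le> n" "S = (\<lambda>i. a + i * d) ` {..<k}"
      using assms by (rule APs_memE)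
    then show "S \<in> (\<lambda>(a, d). (\<lambda>i. a + i * d) ` {..<k}) ` ({1..n} \<times> {1..n})"
      by (intro image_eqI[of _ _ "(a, d)"]) auto
  qed
  then have "card (APs k n) \<le> card ({1..n} \<times> {1..n})"
    by (intro surj_card_le) auto
  then show ?thesis by (simp add: card_cartesian_product power2_eq_square)
qed

lemma finite_APs: "finite (APs k n)"
  by (rule finite_subset[of _ "Pow {1..n}"]) (auto simp: APs_def)

text \<open>The first and last terms are the extreme elements of the set; the comparison
  \<open>le\<close> is applied in both directions.\<close>

lemma arith_prog_params_unique:
  fixes a a' d d' :: nat
  assumes eq: "(\<lambda>i. a + i * d) ` {..<k} = (\<lambda>i. a' + i * d') ` {..<k}" and "2 \<le> k"
  shows "a = a' \<and> d = d'"
proof -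
  have le: "b \<le> c \<and> c + (k - 1) * e \<le> b + (k - 1) * f"
    if "(\<lambda>i. c + i * e) ` {..<k} = (\<lambda>i. b + i * f) ` {..<k}" for b c e f :: nat
  proof -
    have "c + 0 * e \<in> (\<lambda>i. b + i * f) ` {..<k}" "c + (k - 1) * e \<in> (\<lambda>i. b + i * f) ` {..<k}"
      unfolding that[symmetric] using \<open>2 \<le> k\<close> by (intro imageI; simp)+
    then obtain i j where "c + 0 * e = b + i * f" and ij: "j < k" "c + (k - 1) * e = b + j * f"
      by blast
    then have c: "c = b + i * f" by simp
    have "j * f \<le> (k - 1) * f" using ij(1) by (intro mult_right_mono) auto
    then show ?thesis using ij(2) c by simp
  qed
  have 1: "a = a'" using le[OF eq] le[OF eq[symmetric]] by simp
  then have "(k - 1) * d = (k - 1) * d'" using le[OF eq] le[OF eq[symmetric]] by linarith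
  then show ?thesis using 1 \<open>2 \<le> k\<close> by simp
qed

text \<open>First terms up to \<open>n / 2\<close> and differences up to \<open>n / (2 * k)\<close>
  always fit and give distinct progressions. Each rounding down loses at most a factor 2, so the
  constant is 4 * 4 * \<open>k\<close>.\<close>

lemma card_APs_ge:
  assumes "2 \<le> k" and "2 * k \<le> n"
  shows "(real n)\<^sup>2 / (16 * real k) \<le> real (card (APs k n))"
proof -
  let ?f = "\<lambda>(a, d). (\<lambda>i::nat. (a::nat) + i * d) ` {..<k}"
  let ?D = "{1..n div 2} \<times> {1..n div (2 * k)}"
  have inj: "inj_on ?f ?D"
    using arith_prog_params_unique[OF _ assms(1)] by (auto simp: inj_on_def)
  have "?f ` ?D \<subseteq> APs k n"
  proof
    fix S assume "S \<in> ?f ` ?D"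
    then obtain a d where ad: "1 \<le> a" "a \<le> n div 2" "1 \<le> d" "d \<le> n div (2 * k)"
      "S = (\<lambda>i. a + i * d) ` {..<k}" by auto
    have "a + i * d \<le> n" if "i < k" for i
    proof -
      have "i * d \<le> k * (n div (2 * k))" using that ad by (intro mult_mono) auto
      also have "\<dots> \<le> n div 2"
        by (metis div_mult2_eq times_div_less_eq_dividend)
      finally show ?thesis using ad(2) by linarith
    qed
    then show "S \<in> APs k n"
      unfolding APs_def using ad arith_progI[of d k a] by auto
  qed
  then have "card ?D \<le> card (APs k n)"
    using card_image[OF inj] card_mono[OF finite_APs] by metis
  then have "(n div 2) * (n div (2 * k)) \<le> card (APs k n)"
    by (simp add: card_cartesian_product)
  then have le: "real (n div 2) * real (n div (2 * k)) \<le> real (card (APs k n))"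
    by (metis of_nat_le_iff of_nat_mult)
  have half: "real n / (2 * real m) \<le> real (n div m)" if "0 < m" "m \<le> n" for m
  proof -
    have "1 \<le> n div m" using that by (simp add: Suc_le_eq div_greater_zero_iff)
    moreover have "real n < real m * (real (n div m) + 1)"
    proof -
      have "n < m * (n div m + 1)" using that dividend_less_times_div by simp
      then show ?thesis by (metis of_nat_1 of_nat_add of_nat_less_iff of_nat_mult)
    qed
    moreover have "real m * (real (n div m) + 1) \<le> real m * (2 * real (n div m))"
      using \<open>1 \<le> n div m\<close> by (intro mult_left_mono) auto
    ultimately have "real n \<le> real m * (2 * real (n div m))" by linarith
    then show ?thesis using that by (simp add: field_simps)
  qed
  have "(real n)\<^sup>2 / (16 * real k) = (real n / (2 * real 2)) * (real n / (2 * real (2 * k)))"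
    by (simp add: power2_eq_square)
  also have "\<dots> \<le> real (n div 2) * real (n div (2 * k))"
    using assms by (intro mult_mono half) auto
  finally show ?thesis using le by linarith
qed

lemma num_AP_interval: "num_AP k {1..n} = card (APs k n)"
  by (simp add: num_AP_def APs_def)

lemma prob_superset_random_subset:
  assumes "U \<subseteq> {1..n}" and "0 < p" and "p \<le> 1"
  shows "measure_pmf.prob (random_subset n p) {A. U \<subseteq> A} = p ^ card U"
proof -
  have "measure_pmf.prob (random_subset n p) {A. U \<subseteq> A} =
    measure_pmf.prob (Pi_pmf {1..n} False (\<lambda>_. bernoulli_pmf p))
      ((\<lambda>f. {x \<in> {1..n}. f x}) -` {A. U \<subseteq> A})"
    unfolding random_subset_def by (rule measure_map_pmf)
  also have "(\<lambda>f. {x \<in> {1..n}. f x}) -` {A. U \<subseteq> A} =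
      Pi {1..n} (\<lambda>x. if x \<in> U then {True} else UNIV)"
    using assms(1) by (auto simp: Pi_def)
  also have "measure_pmf.prob (Pi_pmf {1..n} False (\<lambda>_. bernoulli_pmf p)) \<dots> =
      (\<Prod>x\<in>{1..n}. measure_pmf.prob (bernoulli_pmf p) (if x \<in> U then {True} else UNIV))"
    by (intro measure_Pi_pmf_Pi) simp
  also have "\<dots> = (\<Prod>x\<in>{1..n}. if x \<in> U then p else 1)"
    using assms by (intro prod.cong) (auto simp: measure_pmf_single)
  also have "\<dots> = p ^ card ({1..n} \<inter> U)"
    by (simp add: prod.If_cases)
  also have "{1..n} \<inter> U = U" using assms(1) by auto
  finally show ?thesis .
qed

section \<open>Asymptotics and conclusion\<close>

text \<open>An interval of length \<open>m\<close> has at least \<open>m\<^sup>2 / (16 * k)\<close>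
  progressions, so a multiple of \<open>sqrt x\<close> suffices; if that is longer than
  \<open>n\<close>, the whole of \<open>{1..n}\<close> serves, by the last hypothesis.\<close>

lemma exists_planted_interval:
  assumes "2 \<le> k" and "2 * k \<le> n" and "1 \<le> x" and "x \<le> real (card (APs k n))"
  shows "\<exists>m\<le>n. x \<le> real (card (APs k m)) \<and> real m \<le> 7 * real k * sqrt x"
proof -
  \<comment> \<open>The summand \<open>2 * k\<close> makes \<open>card_APs_ge\<close> applicable to
    \<open>m\<close>. With \<open>1 \<le> sqrt x\<close> and rounding, the total is at most 3 + 4 =
    7 times \<open>k * sqrt x\<close>.\<close>
  define m where "m = 2 * k + nat \<lceil>4 * real k * sqrt x\<rceil>"
  have sx: "1 \<le> sqrt x" using assms(3) by simp
  have m_ub: "real m \<le> 7 * real k * sqrt x"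
  proof -
    have "0 \<le> 4 * real k * sqrt x" using assms(3) by simp
    then have "real m \<le> 2 * real k + (4 * real k * sqrt x + 1)" unfolding m_def by linarith
    also have "\<dots> \<le> 3 * real k + 4 * real k * sqrt x" using assms(1) by simp
    also have "\<dots> \<le> 3 * real k * sqrt x + 4 * real k * sqrt x"
      using mult_left_mono[OF sx, of "3 * real k"] by simp
    finally show ?thesis by simp
  qed
  show ?thesis
  proof (cases "m \<le> n")
    case True
    have "4 * real k * sqrt x \<le> real m" unfolding m_def by linarith
    then have "(4 * real k * sqrt x)\<^sup>2 \<le> (real m)\<^sup>2" using assms(3) by (intro power_mono) auto
    moreover have "(4 * real k * sqrt x)\<^sup>2 = 16 * real k * (real k * (sqrt x)\<^sup>2)"
      by (simp add: power2_eq_square)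
    moreover have "(sqrt x)\<^sup>2 = x" using assms(3) by simp
    ultimately have "16 * real k * (real k * x) \<le> (real m)\<^sup>2" by (simp only:)
    then have "real k * x \<le> (real m)\<^sup>2 / (16 * real k)"
      using assms(1) by (simp add: pos_le_divide_eq mult_ac)
    also have "\<dots> \<le> real (card (APs k m))" by (rule card_APs_ge[OF assms(1)]) (simp add: m_def)
    finally have "real k * x \<le> real (card (APs k m))" .
    moreover have "1 * x \<le> real k * x" using assms by (intro mult_right_mono) auto
    ultimately show ?thesis using True m_ub by (intro exI[of _ m]) simp
  next
    case False
    then show ?thesis using m_ub assms(4) by (intro exI[of _ n]) simp
  qed
qed

text \<open>The density parameter is the square root of the constant \<open>1 / (16 * k)\<close> in
  \<open>card_APs_ge\<close>.\<close>

lemma dense_binomial_hypergraph_APs: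
  assumes "3 \<le> k" and "2 * k \<le> n" and "0 < p" and "p \<le> 1"
  shows "dense_binomial_hypergraph {1..n} (APs k n) k (k * n) (k\<^sup>2) p (random_subset n p) n
    (1 / (4 * sqrt (real k)))"
proof
  have k2: "2 \<le> k" using assms(1) by simp
  show "card {S \<in> APs k n. v \<in> S} \<le> k * n" for v using card_APs_degree_le[OF k2] .
  show "card {S \<in> APs k n. x \<in> S \<and> y \<in> S} \<le> k\<^sup>2" if "x \<noteq> y" for x y
    using card_APs_codegree_le[OF k2 that] .
  show "A \<subseteq> {1..n}" if "A \<in> set_pmf (random_subset n p)" for A
    using that by (auto simp: random_subset_def)
  show "measure_pmf.prob (random_subset n p) {A. U \<subseteq> A} = p ^ card U" if "U \<subseteq> {1..n}" for U
    using prob_superset_random_subset[OF that assms(3,4)] .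
  show "1 / (4 * sqrt (real k)) \<le> 1"
  proof -
    have "1 \<le> sqrt (real k)" using assms(1) by simp
    then have "1 \<le> 4 * sqrt (real k)" by linarith
    then show ?thesis using assms(1) by (simp add: pos_divide_le_eq)
  qed
  show "(1 / (4 * sqrt (real k)))\<^sup>2 * (real n)\<^sup>2 \<le> real (card (APs k n))"
    using card_APs_ge[OF k2 assms(2)] by (simp add: power_divide power_mult_distrib)
qed (use assms in \<open>auto simp: APs_def arith_prog_def\<close>)

section \<open>How large n must be\<close>

lemma eventually_ln_power_le:
  "\<forall>\<^sub>F n in sequentially. C * ln (real n) ^ j \<le> real n"
proof -
  have "((\<lambda>x::real. x ^ j / exp x) \<longlongrightarrow> 0) at_top" by (rule tendsto_power_div_exp_0)
  moreover have "filterlim (\<lambda>n. ln (real n)) at_top sequentially"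
    by (rule filterlim_compose[OF ln_at_top filterlim_real_sequentially])
  ultimately have "((\<lambda>n. ln (real n) ^ j / exp (ln (real n))) \<longlongrightarrow> 0) sequentially"
    by (rule filterlim_compose)
  then have "((\<lambda>n. C * (ln (real n) ^ j / exp (ln (real n)))) \<longlongrightarrow> C * 0) sequentially"
    by (rule tendsto_mult_left)
  then have "\<forall>\<^sub>F n in sequentially. C * (ln (real n) ^ j / exp (ln (real n))) < 1"
    by (intro order_tendstoD(2)[of _ "C * 0"]) auto
  then show ?thesis using eventually_gt_at_top[of 0]
  proof eventually_elim
    case (elim n)
    then have "C * ln (real n) ^ j / real n < 1" by simp
    then show ?case using elim(2) by (simp add: pos_divide_less_eq)
  qed
qed

lemma eventually_size_conditions:
  fixes k :: nat and \<sigma> :: real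
  assumes "0 < k" and "0 < \<sigma>"
  shows "\<forall>\<^sub>F n in sequentially. 2 * k \<le> n \<and> 2 \<le> n \<and>
    ln (real n) \<le> real k * \<sigma> * sqrt (real n) \<and>
    256 * ln (real n) ^ 4 * (8 * (real k)\<^sup>2) ^ 3 \<le> \<sigma> ^ 4 * real n \<and>
    (8 * (real k)\<^sup>2 * (32 * real k * (ln (real n))\<^sup>2 + real k)\<^sup>2) ^ k * (16 * (ln (real n))\<^sup>2)
      \<le> \<sigma>\<^sup>2 * (real n)\<^sup>2 \<and>
    12 * real k ^ 6 * (32 * (ln (real n))\<^sup>2)\<^sup>2 \<le> \<sigma>\<^sup>2 * real n"
proof -
  \<comment> \<open>For \<open>1 \<le> ln n\<close> the summand \<open>k\<close> merges into
    \<open>33 * k * (ln n)\<^sup>2\<close>; the third condition then has degree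
    \<open>4 * k + 2\<close> in \<open>ln n\<close> with coefficient \<open>D\<close>.\<close>
  define D where "D = (8 * (real k)\<^sup>2 * (33 * real k)\<^sup>2) ^ k * 16"
  have "filterlim (\<lambda>n. ln (real n)) at_top sequentially"
    by (rule filterlim_compose[OF ln_at_top filterlim_real_sequentially])
  then have z1: "\<forall>\<^sub>F n in sequentially. 1 \<le> ln (real n)"
    by (auto simp: filterlim_at_top)
  show ?thesis
    using z1 eventually_ge_at_top[of "2 * k"] eventually_ge_at_top[of "2::nat"]
      eventually_ln_power_le[of "1 / (real k * \<sigma>)\<^sup>2" 2]
      eventually_ln_power_le[of "256 * (8 * (real k)\<^sup>2) ^ 3 / \<sigma> ^ 4" 4]
      eventually_ln_power_le[of "D / \<sigma>\<^sup>2" "4 * k + 2"]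
      eventually_ln_power_le[of "12 * real k ^ 6 * 1024 / \<sigma>\<^sup>2" 4]
  proof eventually_elim
    case (elim n)
    define z where "z = ln (real n)"
    have z: "1 \<le> z" using elim(1) by (simp add: z_def)
    have n1: "1 \<le> real n" using elim(3) by simp
    have 1: "z \<le> real k * \<sigma> * sqrt (real n)"
    proof -
      have "z\<^sup>2 \<le> (real k * \<sigma>)\<^sup>2 * real n"
        using elim(4) assms unfolding z_def[symmetric] by (simp add: pos_divide_le_eq mult.commute)
      then have "sqrt (z\<^sup>2) \<le> sqrt ((real k * \<sigma>)\<^sup>2 * real n)" by (rule real_sqrt_le_mono)
      then show ?thesis using z assms by (simp add: real_sqrt_mult)
    qed
    have 2: "256 * z ^ 4 * (8 * (real k)\<^sup>2) ^ 3 \<le> \<sigma> ^ 4 * real n"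
      using elim(5) assms unfolding z_def[symmetric] by (simp add: pos_divide_le_eq mult_ac)
    have 3: "(8 * (real k)\<^sup>2 * (32 * real k * z\<^sup>2 + real k)\<^sup>2) ^ k * (16 * z\<^sup>2) \<le> \<sigma>\<^sup>2 * (real n)\<^sup>2"
    proof -
      have "real k * 1 \<le> real k * z\<^sup>2" using z by (intro mult_left_mono) (simp_all add: one_le_power)
      then have "32 * real k * z\<^sup>2 + real k \<le> 33 * real k * z\<^sup>2" by simp
      then have "(32 * real k * z\<^sup>2 + real k)\<^sup>2 \<le> (33 * real k * z\<^sup>2)\<^sup>2" by (intro power_mono) auto
      then have "8 * (real k)\<^sup>2 * (32 * real k * z\<^sup>2 + real k)\<^sup>2 \<le> 8 * (real k)\<^sup>2 * (33 * real k * z\<^sup>2)\<^sup>2"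
        by (intro mult_left_mono) auto
      then have "(8 * (real k)\<^sup>2 * (32 * real k * z\<^sup>2 + real k)\<^sup>2) ^ k * (16 * z\<^sup>2)
          \<le> (8 * (real k)\<^sup>2 * (33 * real k * z\<^sup>2)\<^sup>2) ^ k * (16 * z\<^sup>2)"
        by (intro mult_right_mono power_mono) auto
      also have "8 * (real k)\<^sup>2 * (33 * real k * z\<^sup>2)\<^sup>2 = (8 * (real k)\<^sup>2 * (33 * real k)\<^sup>2) * z ^ 4"
        by (simp add: power_mult_distrib flip: power_mult)
      also have "((8 * (real k)\<^sup>2 * (33 * real k)\<^sup>2) * z ^ 4) ^ k * (16 * z\<^sup>2) = D * z ^ (4 * k + 2)"
      proof -
        have "(a * z ^ 4) ^ k * (16 * z\<^sup>2) = a ^ k * 16 * z ^ (4 * k + 2)" for a :: real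
          by (simp add: power_mult_distrib power_add power_mult power2_eq_square)
        then show ?thesis unfolding D_def .
      qed
      also have "\<dots> \<le> \<sigma>\<^sup>2 * real n"
        using elim(6) assms unfolding z_def[symmetric] by (simp add: pos_divide_le_eq mult_ac)
      also have "\<dots> \<le> \<sigma>\<^sup>2 * (real n)\<^sup>2"
        using mult_left_mono[OF n1, of "real n"] by (intro mult_left_mono) (simp_all add: power2_eq_square)
      finally show ?thesis .
    qed
    have "(32 * z\<^sup>2)\<^sup>2 = 1024 * z ^ 4" by (simp add: power_mult_distrib flip: power_mult)
    then have 4: "12 * real k ^ 6 * (32 * z\<^sup>2)\<^sup>2 \<le> \<sigma>\<^sup>2 * real n"
      using elim(7) assms unfolding z_def[symmetric] by (simp add: pos_divide_le_eq mult_ac)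
    show ?case using elim(2,3) 1 2 3 4 unfolding z_def[symmetric] by blast
  qed
qed

theorem theorem1p1:
  fixes k :: nat
  assumes "k \<ge> 3"
  shows "\<exists>(n\<^sub>0::nat) (b::real) (B::real). n\<^sub>0 > 0 \<and> b > 0 \<and> B > 0 \<and>
    (\<forall>(n::nat) (p::real) (\<epsilon>::real). n \<ge> n\<^sub>0 \<and> 0 < p \<and> p \<le> 1 \<and> \<epsilon> > 0 \<longrightarrow>
      (let \<mu> = mean_AP k n p;
           \<Phi> = rate_Phi k n p;
           c = b * min (\<epsilon> ^ 3) (\<epsilon> powr (1 / 2));
           C = B * max 1 (\<epsilon> ^ 2);
           P = measure_pmf.prob (random_subset n p) {A. real (num_AP k A) \<ge> (1 + \<epsilon>) * \<mu>}
       in of_bool (1 \<le> (1 + \<epsilon>) * \<mu> \<and> (1 + \<epsilon>) * \<mu> \<le> real (num_AP k {1..n})) * exp (- C * \<Phi>) \<le> P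
          \<and> P \<le> exp (- c * \<Phi>)))"
proof -
  define \<sigma> where "\<sigma> = 1 / (4 * sqrt (real k))"
  have \<sigma>: "0 < \<sigma>" using assms by (simp add: \<sigma>_def)
  obtain N where N: "\<And>n. N \<le> n \<Longrightarrow> 2 * k \<le> n \<and> 2 \<le> n \<and>
    ln (real n) \<le> real k * \<sigma> * sqrt (real n) \<and>
    256 * ln (real n) ^ 4 * (8 * (real k)\<^sup>2) ^ 3 \<le> \<sigma> ^ 4 * real n \<and>
    (8 * (real k)\<^sup>2 * (32 * real k * (ln (real n))\<^sup>2 + real k)\<^sup>2) ^ k * (16 * (ln (real n))\<^sup>2)
      \<le> \<sigma>\<^sup>2 * (real n)\<^sup>2 \<and>
    12 * real k ^ 6 * (32 * (ln (real n))\<^sup>2)\<^sup>2 \<le> \<sigma>\<^sup>2 * real n"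
    using eventually_size_conditions[of k \<sigma>] assms \<sigma> unfolding eventually_sequentially by auto
  define b where "b = \<sigma> / (23040 * real k ^ 5)"
  define B where "B = 200 * real k"
  have main: "of_bool (1 \<le> (1 + \<epsilon>) * mean_AP k n p \<and> (1 + \<epsilon>) * mean_AP k n p \<le> real (num_AP k {1..n}))
        * exp (- (B * max 1 (\<epsilon> ^ 2)) * rate_Phi k n p)
      \<le> measure_pmf.prob (random_subset n p) {A. real (num_AP k A) \<ge> (1 + \<epsilon>) * mean_AP k n p}
    \<and> measure_pmf.prob (random_subset n p) {A. real (num_AP k A) \<ge> (1 + \<epsilon>) * mean_AP k n p}
      \<le> exp (- (b * min (\<epsilon> ^ 3) (\<epsilon> powr (1 / 2))) * rate_Phi k n p)"
    if n: "N + 1 \<le> n" and p: "0 < p" "p \<le> 1" and \<epsilon>: "0 < \<epsilon>" for n :: nat and p \<epsilon> :: real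
  proof -
    have Nn: "N \<le> n" using n by simp
    note size = N[OF Nn]
    have n2k: "2 * k \<le> n" using size by blast
    interpret H: dense_binomial_hypergraph "{1..n}" "APs k n" k "k * n" "k\<^sup>2" p "random_subset n p" n \<sigma>
      unfolding \<sigma>_def by (rule dense_binomial_hypergraph_APs[OF assms n2k p])
    \<comment> \<open>\<open>H.num_edges\<close> sees only progressions inside
      \<open>{1..n}\<close>, so the identifications below use the support of the random set.\<close>
    have num: "num_AP k A = H.num_edges A" if "A \<subseteq> {1..n}" for A
      unfolding num_AP_def H.num_edges_def
      using that by (intro arg_cong[of _ _ card]) (auto simp: APs_def)
    have mean: "mean_AP k n p = H.\<mu>"
      unfolding mean_AP_def H.\<mu>_def H.E_num_edges[symmetric] by (rule H.E_cong) (simp add: num)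
    have rate: "rate_Phi k n p = H.\<Phi>"
      by (simp add: rate_Phi_def H.\<Phi>_def H.L_def mean)
    have prob: "measure_pmf.prob (random_subset n p) {A. (1 + \<epsilon>) * H.\<mu> \<le> real (num_AP k A)} =
        measure_pmf.prob (random_subset n p) {A. (1 + \<epsilon>) * H.\<mu> \<le> real (H.num_edges A)}"
      by (intro antisym H.prob_mono) (simp_all add: num)
    have lower: "exp (- (B * max 1 (\<epsilon> ^ 2)) * H.\<Phi>)
        \<le> measure_pmf.prob (random_subset n p) {A. (1 + \<epsilon>) * H.\<mu> \<le> real (H.num_edges A)}"
      if x: "1 \<le> (1 + \<epsilon>) * H.\<mu>" "(1 + \<epsilon>) * H.\<mu> \<le> real (num_AP k {1..n})"
    proof -
      obtain m where m: "m \<le> n" "(1 + \<epsilon>) * H.\<mu> \<le> real (card (APs k m))"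
        "real m \<le> 7 * real k * sqrt ((1 + \<epsilon>) * H.\<mu>)"
        using exists_planted_interval[OF _ n2k x(1)] x(2) assms unfolding num_AP_interval by auto
      have W: "{1..m} \<subseteq> {1..n}" using m(1) by simp
      have "exp (- (200 * real k * max 1 (\<epsilon>\<^sup>2) * H.\<Phi>))
        \<le> measure_pmf.prob (random_subset n p) {A. (1 + \<epsilon>) * H.\<mu> \<le> real (H.num_edges A)}"
      proof (rule H.lower_tail[OF \<epsilon> _ x(1) _ W])
        show "card (APs k n) \<le> n\<^sup>2" using assms by (intro card_APs_le) simp
        show "(1 + \<epsilon>) * H.\<mu> \<le> real (H.num_edges {1..m})"
          unfolding num[OF W, symmetric] num_AP_interval by (rule m(2))
      qed (use size m(3) in simp_all)
      then show ?thesis by (simp add: B_def)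
    qed
    have upper: "measure_pmf.prob (random_subset n p) {A. (1 + \<epsilon>) * H.\<mu> \<le> real (H.num_edges A)}
        \<le> exp (- (b * min (\<epsilon> ^ 3) (\<epsilon> powr (1 / 2))) * H.\<Phi>)"
    proof (cases "p < 1")
      case True
      have "ln (real n) \<le> real k * max H.L (sqrt H.\<mu>)"
        using size by (intro H.ln_n_le) blast
      from H.upper_tail[OF True this \<epsilon>] show ?thesis
        using \<epsilon> by (simp add: b_def powr_half_sqrt)
    next
      \<comment> \<open>For \<open>p = 1\<close> the star estimates are void, but
        \<open>L = 0\<close> makes the rate vanish and the claimed bound is 1.\<close>
      case False
      then have "ln (1 / p) = 0" using p by simp
      then have "H.L = 0" by (simp only: H.L_def)
      then have "H.\<Phi> = 0" using H.\<mu>_pos by (simp add: H.\<Phi>_def)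
      then show ?thesis by simp
    qed
    show ?thesis
      unfolding mean rate prob using lower upper by (auto simp: of_bool_def)
  qed
  show ?thesis
    unfolding Let_def
    by (rule exI[of _ "N + 1"], rule exI[of _ b], rule exI[of _ B])
      (use main \<sigma> assms in \<open>auto simp: b_def B_def\<close>)
qed

end
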